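(* Let $F$ be a field and let $n\ge 0$ be an integer. The Hilbert series of the quadratic algebra $Q_n$ over $F$ is $$H(Q_n,t)=\frac{1-t}{1-t(2-t)^n}.$$
   Context: Definition of $Q_n$. Let $V$ be the $F$-vector space with basis $\{v(A): \emptyset\neq A\subseteq\{1,\dots,n\}\}$, and put $v(\emptyset)=0$. Let $T(V)$ be the tensor algebra. For $A\subseteq\{1,\dots,n\}$ and distinct $i,j\in A$ put $$\mathcal V(A:\{i,j\})=v(A)\bigl(v(A\setminus\{i\})-v(A\setminus\{j\})\bigr)+\bigl(v(A\setminus\{i\})-v(A\setminus\{j\})\bigr)v(A\setminus\{i,j\})-v(A\setminus\{i\})^2+v(A\setminus\{j\})^2$$ (well defined up to sign). Then $Q_n$ is the quotient of $T(V)$ by the two-sided ideal generated by all $\mathcal V(A:\{i,j\})$, $A\subseteq\{1,\dots,n\}$, $i\neq j\in A$. It is graded, $Q_n=\sum_{i\ge0}Q_{n,i}$, each generator (image of $v(A)$) having degree $1$; $Q_0=F$. For a graded vector space $W=\sum_{i\ge 0}W_i$ with all $W_i$ finite dimensional, the Hilbert series is $H(W,t)=\sum_{i\ge0}(\dim W_i)t^i$. *)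

theory Defs
  imports
    "HOL-Algebra.Embedded_Algebras"
    "HOL-Algebra.QuotRing"
    "HOL-Library.Poly_Mapping"
    "HOL-Computational_Algebra.Formal_Power_Series"
begin

text \<open>The free monoid on \<open>'x\<close>, written additively so that \<open>'x fword \<Rightarrow>\<^sub>0 'f\<close> carries the
  convolution product of \<^theory>\<open>HOL-Library.Poly_Mapping\<close>, which concatenates words.\<close>

datatype 'x fword = Word (letters: "'x list")

instantiation fword :: (type) monoid_add
begin

definition zero_fword :: "'x fword" where
  "zero_fword = Word []"

definition plus_fword :: "'x fword \<Rightarrow> 'x fword \<Rightarrow> 'x fword" where
  "plus_fword u w = Word (letters u @ letters w)"

instance
  by standard (simp_all add: zero_fword_def plus_fword_def)

end

text \<open>The tensor algebra of a vector space with basis \<open>X\<close>. The words of length \<open>i\<close> in \<open>X\<close> are the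
  induced basis of the \<open>i\<close>-th tensor power, and the product of two words is their
  concatenation.\<close>

definition tensor_algebra :: "'x set \<Rightarrow> ('x fword \<Rightarrow>\<^sub>0 'f::field) ring" where
  "tensor_algebra X =
     \<lparr>carrier = {p. \<forall>w\<in>Poly_Mapping.keys p. set (letters w) \<subseteq> X},
      monoid.mult = (*), one = 1, zero = 0, add = (+)\<rparr>"

definition tensor_power :: "'x set \<Rightarrow> nat \<Rightarrow> ('x fword \<Rightarrow>\<^sub>0 'f::field) set" where
  "tensor_power X i =
     {p \<in> carrier (tensor_algebra X). \<forall>w\<in>Poly_Mapping.keys p. length (letters w) = i}"

lemma tensor_algebra_is_ring: "ring (tensor_algebra X)"
proof (rule ringI)
  show "abelian_group (tensor_algebra X)"
  proof (rule abelian_groupI, goal_cases)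
    case (1 x y)
    then show ?case using keys_add[of x y] by (auto simp: tensor_algebra_def)
  next
    case (6 x)
    then show ?case
      by (intro bexI[of _ "- x"]) (auto simp: tensor_algebra_def in_keys_iff)
  qed (auto simp: tensor_algebra_def algebra_simps)
  show "Group.monoid (tensor_algebra X)"
  proof (rule Group.monoidI, goal_cases)
    case (1 x y)
    then show ?case using keys_mult[of x y] by (fastforce simp: tensor_algebra_def plus_fword_def)
  qed (auto simp: tensor_algebra_def algebra_simps zero_fword_def)
qed (auto simp: tensor_algebra_def algebra_simps)

definition Q_basis :: "nat \<Rightarrow> nat set set" where
  "Q_basis n = {A. A \<noteq> {} \<and> A \<subseteq> {1..n}}"

definition v :: "nat set \<Rightarrow> nat set fword \<Rightarrow>\<^sub>0 'f::field" where
  "v A = (if A = {} then 0 else Poly_Mapping.single (Word [A]) 1)"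

definition Q_relation :: "nat set \<Rightarrow> nat \<Rightarrow> nat \<Rightarrow> nat set fword \<Rightarrow>\<^sub>0 'f::field" where
  "Q_relation A i j =
     v A * (v (A - {i}) - v (A - {j})) + (v (A - {i}) - v (A - {j})) * v (A - {i, j})
       - v (A - {i}) ^ 2 + v (A - {j}) ^ 2"

definition Q_relations :: "nat \<Rightarrow> (nat set fword \<Rightarrow>\<^sub>0 'f::field) set" where
  "Q_relations n = {Q_relation A i j | A i j. A \<subseteq> {1..n} \<and> i \<in> A \<and> j \<in> A \<and> i \<noteq> j}"

definition Q_ideal :: "nat \<Rightarrow> (nat set fword \<Rightarrow>\<^sub>0 'f::field) set" where
  "Q_ideal n = genideal (tensor_algebra (Q_basis n)) (Q_relations n)"

definition Q_algebra :: "nat \<Rightarrow> (nat set fword \<Rightarrow>\<^sub>0 'f::field) set ring" where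
  "Q_algebra n = tensor_algebra (Q_basis n) Quot Q_ideal n"

definition Q_proj ::
    "nat \<Rightarrow> (nat set fword \<Rightarrow>\<^sub>0 'f::field) \<Rightarrow> (nat set fword \<Rightarrow>\<^sub>0 'f) set" where
  "Q_proj n p = Q_ideal n +>\<^bsub>tensor_algebra (Q_basis n)\<^esub> p"

lemma tensor_algebra_minus:
  assumes "p \<in> carrier (tensor_algebra X)" "q \<in> carrier (tensor_algebra X)"
  shows "p - q \<in> carrier (tensor_algebra X)"
proof -
  have "w \<in> Poly_Mapping.keys p \<or> w \<in> Poly_Mapping.keys q"
    if "w \<in> Poly_Mapping.keys (p - q)" for w
    using that keys_diff[of p q] by blast
  then show ?thesis
    using assms by (fastforce simp: tensor_algebra_def)
qed

lemma v_in_tensor_algebra: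
  "A \<subseteq> {1..n} \<Longrightarrow> v A \<in> carrier (tensor_algebra (Q_basis n))"
  by (auto simp: v_def tensor_algebra_def Q_basis_def)

lemma Q_relations_subset:
  "(Q_relations n :: (nat set fword \<Rightarrow>\<^sub>0 'f::field) set)
    \<subseteq> carrier (tensor_algebra (Q_basis n))"
proof -
  let ?T = "tensor_algebra (Q_basis n) :: (nat set fword \<Rightarrow>\<^sub>0 'f) ring"
  interpret T: ring ?T by (rule tensor_algebra_is_ring)
  have mult: "p * q \<in> carrier ?T" and add: "p + q \<in> carrier ?T"
    if "p \<in> carrier ?T" "q \<in> carrier ?T" for p q
    using T.m_closed[OF that] T.a_closed[OF that] by (simp_all add: tensor_algebra_def)
  have "Q_relation A i j \<in> carrier ?T" if "A \<subseteq> {1..n}" for A i j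
    unfolding Q_relation_def power2_eq_square
    using that by (intro add tensor_algebra_minus mult v_in_tensor_algebra) auto
  then show ?thesis
    by (auto simp: Q_relations_def)
qed

lemma Q_ideal_is_ideal: "ideal (Q_ideal n) (tensor_algebra (Q_basis n))"
  unfolding Q_ideal_def
  by (rule ring.genideal_ideal[OF tensor_algebra_is_ring Q_relations_subset])

lemma Q_algebra_is_ring: "ring (Q_algebra n)"
  unfolding Q_algebra_def by (rule ideal.quotient_is_ring[OF Q_ideal_is_ideal])

definition Q_component :: "nat \<Rightarrow> nat \<Rightarrow> (nat set fword \<Rightarrow>\<^sub>0 'f::field) set set" where
  "Q_component n i = Q_proj n ` tensor_power (Q_basis n) i"

text \<open>The copy of the ground field inside \<open>Q_algebra n\<close>, over which dimensions are taken.\<close>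

definition Q_scalars :: "nat \<Rightarrow> (nat set fword \<Rightarrow>\<^sub>0 'f::field) set set" where
  "Q_scalars n = range (\<lambda>c. Q_proj n (Poly_Mapping.single 0 c))"

lemma one_notin_Q_ideal: "(1 :: nat set fword \<Rightarrow>\<^sub>0 'f::field) \<notin> Q_ideal n"
proof -
  let ?T = "tensor_algebra (Q_basis n) :: (nat set fword \<Rightarrow>\<^sub>0 'f) ring"
  let ?J = "{p \<in> carrier ?T. 0 \<notin> Poly_Mapping.keys p}"
  interpret T: ring ?T by (rule tensor_algebra_is_ring)
  have mult0: "0 \<in> Poly_Mapping.keys p \<and> 0 \<in> Poly_Mapping.keys q"
    if "0 \<in> Poly_Mapping.keys (p * q)" for p q :: "nat set fword \<Rightarrow>\<^sub>0 'f"
    using subsetD[OF keys_mult that]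
    by (auto simp: zero_fword_def plus_fword_def) (metis fword.collapse)+
  have "ideal ?J ?T"
  proof (rule idealI)
    show "subgroup ?J (add_monoid ?T)"
    proof (rule T.add.subgroupI)
      fix a assume a: "a \<in> ?J"
      have "\<ominus>\<^bsub>?T\<^esub> a = - a"
        using a by (intro T.minus_equality) (auto simp: tensor_algebra_def in_keys_iff)
      moreover have "\<ominus>\<^bsub>?T\<^esub> a \<in> carrier ?T"
        using a by (intro T.a_inv_closed) auto
      ultimately show "\<ominus>\<^bsub>?T\<^esub> a \<in> ?J"
        using a by (auto simp: in_keys_iff)
    next
      fix a b assume ab: "a \<in> ?J" "b \<in> ?J"
      then have "a \<oplus>\<^bsub>?T\<^esub> b \<in> carrier ?T" by auto
      then show "a \<oplus>\<^bsub>?T\<^esub> b \<in> ?J"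
        using ab by (auto simp: tensor_algebra_def in_keys_iff lookup_add)
    qed (auto simp: tensor_algebra_def intro!: exI[of _ 0])
  next
    fix a x assume ax: "a \<in> ?J" "x \<in> carrier ?T"
    then have "x \<otimes>\<^bsub>?T\<^esub> a \<in> carrier ?T" "a \<otimes>\<^bsub>?T\<^esub> x \<in> carrier ?T" by auto
    then show "x \<otimes>\<^bsub>?T\<^esub> a \<in> ?J" "a \<otimes>\<^bsub>?T\<^esub> x \<in> ?J"
      using ax mult0[of x a] mult0[of a x] by (auto simp: tensor_algebra_def)
  qed (rule T.ring_axioms)
  moreover have "Q_relations n \<subseteq> ?J"
  proof -
    have v0: "Poly_Mapping.lookup (v A :: nat set fword \<Rightarrow>\<^sub>0 'f) 0 = 0" for A
      by (simp add: v_def lookup_single zero_fword_def)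
    have "Poly_Mapping.lookup (p * q) 0 = 0" if "Poly_Mapping.lookup p 0 = 0"
      for p q :: "nat set fword \<Rightarrow>\<^sub>0 'f"
      using mult0[of p q] that by (auto simp: in_keys_iff)
    then have "Poly_Mapping.lookup (Q_relation A i j :: nat set fword \<Rightarrow>\<^sub>0 'f) 0 = 0" for A i j
      by (simp add: Q_relation_def power2_eq_square lookup_add lookup_minus v0)
    then have "0 \<notin> Poly_Mapping.keys p"
      if "p \<in> Q_relations n" for p :: "nat set fword \<Rightarrow>\<^sub>0 'f"
      using that by (auto simp: Q_relations_def in_keys_iff)
    then show ?thesis
      using Q_relations_subset[of n, where 'f = 'f] by blast
  qed
  ultimately have "Q_ideal n \<subseteq> ?J"
    unfolding Q_ideal_def by (rule T.genideal_minimal)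
  then show ?thesis by auto
qed

lemma Q_scalars_subfield: 
  "subfield (Q_scalars n) (Q_algebra n :: (nat set fword \<Rightarrow>\<^sub>0 'f::field) set ring)"
proof -
  let ?T = "tensor_algebra (Q_basis n) :: (nat set fword \<Rightarrow>\<^sub>0 'f) ring"
  let ?K = "range (Poly_Mapping.single 0) :: (nat set fword \<Rightarrow>\<^sub>0 'f) set"
  interpret T: ring ?T by (rule tensor_algebra_is_ring)
  interpret I: ideal "Q_ideal n" ?T by (rule Q_ideal_is_ideal)
  have K: "?K \<subseteq> carrier ?T"
    by (auto simp: tensor_algebra_def zero_fword_def split: if_splits)
  have "subring ?K ?T"
  proof (rule T.subringI[OF K])
    show "\<one>\<^bsub>?T\<^esub> \<in> ?K" by (auto simp: tensor_algebra_def intro!: image_eqI[of _ _ 1])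
  next
    fix h assume h: "h \<in> ?K"
    then obtain c where c: "h = Poly_Mapping.single 0 c" by auto
    have "\<ominus>\<^bsub>?T\<^esub> h = Poly_Mapping.single 0 (- c)"
      using h K c
      by (intro T.minus_equality)
        (auto simp: tensor_algebra_def zero_fword_def simp flip: single_add)
    then show "\<ominus>\<^bsub>?T\<^esub> h \<in> ?K" by auto
  next
    fix g h assume "g \<in> ?K" "h \<in> ?K"
    then show "g \<otimes>\<^bsub>?T\<^esub> h \<in> ?K" "g \<oplus>\<^bsub>?T\<^esub> h \<in> ?K"
      by (auto simp: tensor_algebra_def mult_single simp flip: single_add)
  qed
  then have "subcring ?K ?T"
    by (rule T.subcringI) (auto simp: tensor_algebra_def mult_single mult.commute)
  moreover have "Units (?T\<lparr>carrier := ?K\<rparr>) = ?K - {\<zero>\<^bsub>?T\<^esub>}"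
  proof -
    have "\<exists>d. Poly_Mapping.single 0 d * Poly_Mapping.single 0 c = (1 :: nat set fword \<Rightarrow>\<^sub>0 'f) \<and>
        Poly_Mapping.single 0 c * Poly_Mapping.single 0 d = (1 :: nat set fword \<Rightarrow>\<^sub>0 'f)"
      if "Poly_Mapping.single (0 :: nat set fword) c \<noteq> 0" for c :: 'f
    proof -
      have "c \<noteq> 0" using that by auto
      then show ?thesis by (intro exI[of _ "inverse c"]) (simp add: mult_single)
    qed
    then show ?thesis
      by (auto simp: Units_def tensor_algebra_def)
  qed
  ultimately have sub: "subfield ?K ?T" by (rule T.subfieldI)
  have "\<one>\<^bsub>Q_algebra n\<^esub> \<noteq> \<zero>\<^bsub>Q_algebra n :: (nat set fword \<Rightarrow>\<^sub>0 'f) set ring\<^esub>"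
  proof -
    have "\<one>\<^bsub>?T\<^esub> \<in> Q_ideal n +>\<^bsub>?T\<^esub> \<one>\<^bsub>?T\<^esub>" by (rule I.a_rcos_self) simp
    then show ?thesis
      using one_notin_Q_ideal[of n, where 'f = 'f]
      by (auto simp: Q_algebra_def FactRing_def tensor_algebra_def)
  qed
  then have "subfield ((+>\<^bsub>?T\<^esub>) (Q_ideal n) ` ?K) (Q_algebra n)"
    unfolding Q_algebra_def
    by (intro ring_hom_ring.img_is_subfield(2)[OF I.rcos_ring_hom_ring sub])
  then show ?thesis
    by (simp add: Q_scalars_def Q_proj_def image_image)
qed

text \<open>The components \<open>W i\<close> are subspaces, over the subfield \<open>K\<close>, of the ring \<open>R\<close>.
  The value is meaningful only if all of them are finite-dimensional, as
  \<^const>\<open>ring.dim\<close> is unspecified otherwise.\<close>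

definition hilbert_series ::
    "('a, 'b) ring_scheme \<Rightarrow> 'a set \<Rightarrow> (nat \<Rightarrow> 'a set) \<Rightarrow> rat fps" where
  "hilbert_series R K W = Abs_fps (\<lambda>i. of_nat (ring.dim R K (W i)))"

end

theory Submission
  imports Defs "HOL-Library.Product_Plus"
begin

text \<open>
  With \<open>v' A = v (insert (Suc n) A) - v {Suc n}\<close> and \<open>w = v {Suc n}\<close>, the algebra \<open>Q_algebra (Suc n)\<close>
  is generated by two copies of \<open>Q_algebra n\<close> (the \<open>v A\<close> and the \<open>v' A\<close>, for \<open>A\<close> without \<open>Suc n\<close>)
  and \<open>w\<close>. The relations between these are exactly \<open>w * x = x' * w + nabla x\<close>, where \<open>nabla\<close> is the skew
  derivation from \<open>Q_algebra n\<close> to the free product of the two copies that sends a pseudo-root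
  \<open>x = v B - v A\<close>, \<open>B = insert i A\<close>, to \<open>x' * (v' A - v A) - (v' B - v B) * x\<close>. So
  \<open>Q_algebra (Suc n)\<close> is an HNN-like Ore extension of a free product. Moving \<open>w\<close> to the right past the
  first copy yields normal words, whose counting series satisfies
  \<open>1 / H (Suc n) = (2 - t) / H n - 1\<close>. Linear independence of the normal words follows
  from a module with basis the normal words, built by induction on \<open>n\<close>.\<close>

section \<open>Representations of the free algebra\<close>

text \<open>That normal words span follows by rewriting; the difficulty is independence. Instead of
  a confluence check, operators satisfying all relations are built on the free vector space on
  normal words, such that each normal word sends the empty word to itself. The relations involving
  the index \<open>Suc n\<close> prescribe only the increments of \<open>w * v A - v' A * w\<close>
  along edges of the Boolean lattice. So two things must be checked: the increments agree along both
  paths of every square, which defines \<open>nabla\<close> on generators, and \<open>nabla\<close>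
  then respects the relations of \<open>Q_algebra n\<close>. In both cases the two sides differ only
  in the middle set of a path of length two, and that set can be confined to \<open>qsym\<close>
  terms. The operator for \<open>w\<close> applies \<open>nabla\<close> to a chosen lift of a normal
  word to the free algebra, so the induction must also carry that left multiplication agrees with
  these lifts modulo the relations. For the series: the free product of the two copies has inverse
  series \<open>2 / H n - 1\<close>. After \<open>w\<close> only words not starting in the first
  copy may follow; in the free product they have the series of the free product divided by
  \<open>H n\<close>, which subtracts \<open>t / H n\<close> from the inverse.\<close>

definition scl :: "'f::field \<Rightarrow> ('k \<Rightarrow>\<^sub>0 'f) \<Rightarrow> ('k \<Rightarrow>\<^sub>0 'f)" where
  "scl c p = Poly_Mapping.map ((*) c) p"

lemma lookup_scl [simp]: "Poly_Mapping.lookup (scl c p) k = c * Poly_Mapping.lookup p k"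
  by (simp add: scl_def Poly_Mapping.map.rep_eq when_def)

lemma keys_scl: "Poly_Mapping.keys (scl c p) \<subseteq> Poly_Mapping.keys p"
  by (auto simp: in_keys_iff)

interpretation scl: vector_space scl
  by standard (auto intro!: poly_mapping_eqI simp: lookup_add algebra_simps)

lemma scl_conv_mult: "scl c p = Poly_Mapping.single 0 c * p"
  by (simp add: scl_def mult_map_scale_conv_mult)

lemma scl_mult_left: "scl c p * q = scl c (p * q)" for p :: "'k::monoid_add \<Rightarrow>\<^sub>0 'f::field"
  by (simp add: scl_conv_mult mult.assoc)

lemma scl_mult_right: "p * scl c q = scl c (p * q)" for p :: "'k::monoid_add \<Rightarrow>\<^sub>0 'f::field"
proof -
  have "p * Poly_Mapping.single 0 c = Poly_Mapping.single 0 c * p"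
  proof (induct p rule: update_induct)
    case const
    then show ?case by simp
  next
    case (update p a b)
    have "Poly_Mapping.update a b p = p + Poly_Mapping.single a b"
      using update(1)
      by (intro poly_mapping_eqI) (auto simp: lookup_update lookup_add lookup_single in_keys_iff)
    then show ?case using update by (simp add: algebra_simps mult_single)
  qed
  then show ?thesis by (metis scl_conv_mult mult.assoc)
qed

text \<open>Universal property of the free vector space on \<open>'k\<close>. The scalar
  multiplication of the target is an argument, so that the same notion serves for pairs of vectors
  in the triangular representation below.\<close>

definition ext :: "('f::field \<Rightarrow> 'm \<Rightarrow> 'm) \<Rightarrow> ('k \<Rightarrow> 'm) \<Rightarrow> ('k \<Rightarrow>\<^sub>0 'f) \<Rightarrow> 'm::ab_group_add" where
  "ext s f p = (\<Sum>k\<in>Poly_Mapping.keys p. s (Poly_Mapping.lookup p k) (f k))"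

context vector_space
begin

lemma ext_superset:
  assumes "finite A" "Poly_Mapping.keys p \<subseteq> A"
  shows "ext scale f p = (\<Sum>k\<in>A. scale (Poly_Mapping.lookup p k) (f k))"
  unfolding ext_def using assms by (intro sum.mono_neutral_left) (auto simp: in_keys_iff)

lemma ext_add: "ext scale f (p + q) = ext scale f p + ext scale f q"
proof -
  let ?A = "Poly_Mapping.keys p \<union> Poly_Mapping.keys q"
  have "Poly_Mapping.keys (p + q) \<subseteq> ?A" by (rule keys_add)
  then show ?thesis
    using ext_superset[of ?A p f] ext_superset[of ?A q f] ext_superset[of ?A "p + q" f]
    by (simp add: lookup_add scale_left_distrib sum.distrib)
qed

lemma ext_scl: "ext scale f (scl c p) = scale c (ext scale f p)"
  using ext_superset[OF _ keys_scl[of c p], of f] by (simp add: ext_def scale_sum_right)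

lemma ext_linear: "Vector_Spaces.linear scl scale (ext scale f)"
  by (intro Vector_Spaces.linear.intro module_hom.intro module_hom_axioms.intro
      scl.vector_space_axioms vector_space_axioms scl.module_axioms module_axioms ext_add ext_scl)

lemma ext_single [simp]: "ext scale f (Poly_Mapping.single k c) = scale c (f k)"
  by (simp add: ext_def)

lemma ext_zero [simp]: "ext scale f 0 = 0"
  by (simp add: ext_def)

lemma ext_cong:
  "(\<And>k. k \<in> Poly_Mapping.keys p \<Longrightarrow> f k = g k) \<Longrightarrow> ext scale f p = ext scale g p"
  by (simp add: ext_def)

lemma ext_in_subspace:
  assumes "subspace U" "\<And>k. k \<in> Poly_Mapping.keys p \<Longrightarrow> f k \<in> U"
  shows "ext scale f p \<in> U"
  unfolding ext_def by (intro subspace_sum subspace_scale assms)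

lemma linear_ext:
  assumes "Vector_Spaces.linear scl scale g"
  shows "g p = ext scale (\<lambda>k. g (Poly_Mapping.single k 1)) p"
proof -
  interpret g: Vector_Spaces.linear scl scale g by fact
  have "p = (\<Sum>k\<in>Poly_Mapping.keys p. scl (Poly_Mapping.lookup p k) (Poly_Mapping.single k 1))"
    by (intro poly_mapping_eqI)
      (auto simp: lookup_sum lookup_single when_def in_keys_iff if_distrib[of "(*) _"] cong: if_cong)
  then have "g p = g (\<Sum>k\<in>Poly_Mapping.keys p. scl (Poly_Mapping.lookup p k) (Poly_Mapping.single k 1))"
    by (rule arg_cong)
  also have "\<dots> = ext scale (\<lambda>k. g (Poly_Mapping.single k 1)) p"
    unfolding g.sum g.scale ext_def ..
  finally show ?thesis .
qed

lemma linear_eq_on_basis: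
  assumes "Vector_Spaces.linear scl scale g" "Vector_Spaces.linear scl scale h"
    and "\<And>k. k \<in> Poly_Mapping.keys p \<Longrightarrow> g (Poly_Mapping.single k 1) = h (Poly_Mapping.single k 1)"
  shows "g p = h p"
  unfolding linear_ext[OF assms(1), of p] linear_ext[OF assms(2), of p] by (rule ext_cong[OF assms(3)])

end

lemma ext_single_id [simp]: "ext scl (\<lambda>k. Poly_Mapping.single k 1) p = p"
proof -
  have "Vector_Spaces.linear scl scl (\<lambda>p :: 'a \<Rightarrow>\<^sub>0 'b. p)"
    by (rule scl.linear_id[unfolded id_def])
  from scl.linear_ext[OF this, of p] show ?thesis by (rule sym)
qed

text \<open>The representation of the free algebra in which the letter \<open>x\<close> acts by
  \<open>V x\<close>. With \<open>foldr\<close> the last letter acts first, so products become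
  compositions.\<close>

definition act ::
  "('f::field \<Rightarrow> 'm \<Rightarrow> 'm) \<Rightarrow> ('x \<Rightarrow> 'm \<Rightarrow> 'm) \<Rightarrow> ('x fword \<Rightarrow>\<^sub>0 'f) \<Rightarrow> 'm \<Rightarrow> 'm::ab_group_add" where
  "act s V p m = ext s (\<lambda>w. foldr V (letters w) m) p"

locale free_rep = vector_space s for s :: "'f::field \<Rightarrow> 'm::ab_group_add \<Rightarrow> 'm" +
  fixes V :: "'x \<Rightarrow> 'm \<Rightarrow> 'm"
  assumes V_linear: "Vector_Spaces.linear s s (V x)"
begin

lemma V_add: "V x (p + q) = V x p + V x q"
  by (rule module_hom.add[OF Vector_Spaces.linear.axioms(3)[OF V_linear]])
lemma V_scale: "V x (s c p) = s c (V x p)"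
  by (rule module_hom.scale[OF Vector_Spaces.linear.axioms(3)[OF V_linear]])
lemma V_diff: "V x (p - q) = V x p - V x q"
  by (rule module_hom.diff[OF Vector_Spaces.linear.axioms(3)[OF V_linear]])
lemma V_zero [simp]: "V x 0 = 0"
  by (rule module_hom.zero[OF Vector_Spaces.linear.axioms(3)[OF V_linear]])

lemma word_linear: "Vector_Spaces.linear s s (foldr V xs)"
proof (induct xs)
  case Nil
  then show ?case using linear_id by (simp add: id_def)
next
  case (Cons x xs)
  then show ?case using Vector_Spaces.linear_compose[OF Cons V_linear] by (simp add: o_def)
qed

lemma act_linear: "Vector_Spaces.linear scl s (\<lambda>p. act s V p m)"
  unfolding act_def by (rule ext_linear)

lemma act_add: "act s V (p + q) m = act s V p m + act s V q m"
  unfolding act_def by (rule ext_add)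
lemma act_diff: "act s V (p - q) m = act s V p m - act s V q m"
  by (rule module_hom.diff[OF Vector_Spaces.linear.axioms(3)[OF act_linear]])
lemma act_scl: "act s V (scl c p) m = s c (act s V p m)"
  unfolding act_def by (rule ext_scl)
lemma act_zero [simp]: "act s V 0 m = 0"
  unfolding act_def by simp
lemma act_one [simp]: "act s V 1 m = m"
  by (simp add: act_def zero_fword_def flip: single_one)
lemma act_word [simp]: "act s V (Poly_Mapping.single (Word xs) c) m = s c (foldr V xs m)"
  by (simp add: act_def)

lemma act_linear': "Vector_Spaces.linear s s (act s V p)"
proof -
  note hom = Vector_Spaces.linear.axioms(3)[OF word_linear]
  have "module_hom s s (act s V p)"
  proof (intro module_hom.intro module_hom_axioms.intro module_axioms)
    show "act s V p (m + m') = act s V p m + act s V p m'" for m m'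
      by (simp add: act_def ext_def scale_right_distrib sum.distrib module_hom.add[OF hom])
    show "act s V p (s c m) = s c (act s V p m)" for c m
      unfolding act_def ext_def scale_sum_right module_hom.scale[OF hom]
      by (intro sum.cong refl scale_left_commute)
  qed
  then show ?thesis
    by (simp add: Vector_Spaces.linear_def vector_space_axioms)
qed

lemmas act_hom = Vector_Spaces.linear.axioms(3)[OF act_linear']

lemma act_mult: "act s V (p * q) m = act s V p (act s V q m)"
proof -
  have *: "act s V (Poly_Mapping.single u 1 * q) m = foldr V (letters u) (act s V q m)" for u
  proof (rule linear_eq_on_basis[where g = "\<lambda>q. act s V (Poly_Mapping.single u 1 * q) m"])
    show "Vector_Spaces.linear scl s (\<lambda>q. act s V (Poly_Mapping.single u 1 * q) m)"
      by (intro Vector_Spaces.linear.intro module_hom.intro module_hom_axioms.intro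
          scl.vector_space_axioms vector_space_axioms scl.module_axioms module_axioms)
        (simp_all add: distrib_left act_add act_scl scl_mult_right)
    show "Vector_Spaces.linear scl s (\<lambda>q. foldr V (letters u) (act s V q m))"
      using Vector_Spaces.linear_compose[OF act_linear word_linear] by (simp add: o_def)
  next
    fix k
    show "act s V (Poly_Mapping.single u 1 * Poly_Mapping.single k 1) m =
        foldr V (letters u) (act s V (Poly_Mapping.single k 1) m)"
      by (simp add: mult_single act_def plus_fword_def)
  qed
  show ?thesis
  proof (rule linear_eq_on_basis[where h = "\<lambda>p. act s V p (act s V q m)"])
    show "Vector_Spaces.linear scl s (\<lambda>p. act s V (p * q) m)"
      by (intro Vector_Spaces.linear.intro module_hom.intro module_hom_axioms.intro
          scl.vector_space_axioms vector_space_axioms scl.module_axioms module_axioms)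
        (simp_all add: distrib_right act_add act_scl scl_mult_left)
    show "Vector_Spaces.linear scl s (\<lambda>p. act s V p (act s V q m))"
      by (rule act_linear)
  next
    fix k
    show "act s V (Poly_Mapping.single k 1 * q) m = act s V (Poly_Mapping.single k 1) (act s V q m)"
      unfolding * by (simp add: act_def)
  qed
qed

lemma act_in_subspace:
  assumes "subspace U" "m \<in> U" "\<And>x m. m \<in> U \<Longrightarrow> V x m \<in> U"
  shows "act s V p m \<in> U"
  unfolding act_def
proof (rule ext_in_subspace[OF assms(1)])
  fix k :: "'x fword"
  have "foldr V xs m \<in> U" for xs by (induct xs) (auto simp: assms)
  then show "foldr V (letters k) m \<in> U" .
qed

end


section \<open>Substitution homomorphisms between free algebras\<close>

definition subst :: "('x \<Rightarrow> ('y fword \<Rightarrow>\<^sub>0 'f::field)) \<Rightarrow> ('x fword \<Rightarrow>\<^sub>0 'f) \<Rightarrow> 'y fword \<Rightarrow>\<^sub>0 'f" where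
  "subst g p = act scl (\<lambda>x m. g x * m) p 1"

lemma mult_linear:
  "Vector_Spaces.linear scl scl (\<lambda>m. a * m)" "Vector_Spaces.linear scl scl (\<lambda>m. m * a)"
  for a :: "'k::monoid_add \<Rightarrow>\<^sub>0 'f::field"
  by (intro Vector_Spaces.linear.intro module_hom.intro module_hom_axioms.intro
      scl.vector_space_axioms scl.module_axioms;
      simp add: distrib_left distrib_right scl_mult_left scl_mult_right)+

interpretation mult_rep: free_rep scl "\<lambda>x m. (g x :: 'y fword \<Rightarrow>\<^sub>0 'f::field) * m" for g :: "'x \<Rightarrow> _"
  by unfold_locales (simp_all add: distrib_left scl_mult_right)

lemma subst_linear: "Vector_Spaces.linear scl scl (subst g)"
  unfolding subst_def by (rule mult_rep.act_linear)

text \<open>Left multiplications commute with right multiplication by \<open>m\<close>, so the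
  action on \<open>m\<close> is determined by the action on \<open>1\<close>. This turns the
  multiplicativity of \<open>act\<close> into that of \<open>subst\<close>.\<close>

lemma act_mult_eq_subst: "act scl (\<lambda>x m. g x * m) p m = subst g p * m"
  for p :: "'x fword \<Rightarrow>\<^sub>0 'f::field" and m :: "'y fword \<Rightarrow>\<^sub>0 'f"
proof (rule scl.linear_eq_on_basis[where h = "\<lambda>p. subst g p * m"])
  show "Vector_Spaces.linear scl scl (\<lambda>p. subst g p * m)"
    using Vector_Spaces.linear_compose[OF subst_linear mult_linear(2)] by (simp add: o_def)
next
  fix k :: "'x fword"
  have "foldr (\<lambda>x. (*) (g x)) xs m = foldr (\<lambda>x. (*) (g x)) xs 1 * m" for xs
    by (induct xs) (simp_all add: mult.assoc)
  then show "act scl (\<lambda>x m. g x * m) (Poly_Mapping.single k 1) m = subst g (Poly_Mapping.single k 1) * m"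
    by (simp add: subst_def act_def)
qed (rule mult_rep.act_linear)

lemma subst_mult: "subst g (p * q) = subst g p * subst g q"
proof -
  have "subst g (p * q) = act scl (\<lambda>x m. g x * m) p (subst g q)"
    unfolding subst_def by (rule mult_rep.act_mult)
  then show ?thesis unfolding act_mult_eq_subst .
qed

lemma subst_one [simp]: "subst g 1 = 1" and subst_zero [simp]: "subst g 0 = 0"
  by (simp_all add: subst_def)

lemma subst_add: "subst g (p + q) = subst g p + subst g q"
  and subst_diff: "subst g (p - q) = subst g p - subst g q"
  by (simp_all add: subst_def mult_rep.act_add mult_rep.act_diff)

lemma subst_power: "subst g (p ^ k) = subst g p ^ k"
  by (induct k) (simp_all add: subst_mult)

lemma subst_letter [simp]: "subst g (Poly_Mapping.single (Word [x]) 1) = g x"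
  by (simp add: subst_def)

lemma subst_id:
  assumes "\<And>w x. w \<in> Poly_Mapping.keys p \<Longrightarrow> x \<in> set (letters w) \<Longrightarrow>
    g x = Poly_Mapping.single (Word [x]) 1"
  shows "subst g p = p"
proof (rule scl.linear_eq_on_basis[where h = "\<lambda>p. p"])
  fix k assume k: "k \<in> Poly_Mapping.keys p"
  have "\<forall>x\<in>set xs. g x = Poly_Mapping.single (Word [x]) 1 \<Longrightarrow>
      foldr (\<lambda>x. (*) (g x)) xs 1 = Poly_Mapping.single (Word xs) 1" for xs
    by (induct xs) (simp_all add: mult_single plus_fword_def zero_fword_def flip: single_one)
  then show "subst g (Poly_Mapping.single k 1) = Poly_Mapping.single k 1"
    using assms[OF k] by (simp add: subst_def act_def)
qed (rule subst_linear scl.linear_id[unfolded id_def])+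

lemma (in free_rep) act_subst:
  assumes "\<And>w x m. w \<in> Poly_Mapping.keys p \<Longrightarrow> x \<in> set (letters w) \<Longrightarrow> act s V (g x) m = V' x m"
  shows "act s V (subst g p) m = act s V' p m"
proof (rule linear_eq_on_basis[where g = "\<lambda>p. act s V (subst g p) m"])
  show "Vector_Spaces.linear scl s (\<lambda>p. act s V (subst g p) m)"
    using Vector_Spaces.linear_compose[OF subst_linear act_linear] by (simp add: o_def)
  show "Vector_Spaces.linear scl s (\<lambda>p. act s V' p m)"
    unfolding act_def by (rule ext_linear)
next
  fix k assume k: "k \<in> Poly_Mapping.keys p"
  have "\<forall>x\<in>set xs. \<forall>m. act s V (g x) m = V' x m \<Longrightarrow>
      act s V (foldr (\<lambda>x. (*) (g x)) xs 1) m = foldr V' xs m" for xs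
    by (induct xs) (simp_all add: act_mult)
  then show "act s V (subst g (Poly_Mapping.single k 1)) m = act s V' (Poly_Mapping.single k 1) m"
    using assms[OF k] by (simp add: subst_def act_def[of scl] act_def[of s V'])
qed

text \<open>The ideal is taken in the free algebra on all sets of naturals, so that \<open>a\<close>
  and \<open>b\<close> range over a whole type and no carrier has to be tracked. Scalars and signs
  are absorbed into \<open>a\<close>. The comparison with \<open>Q_ideal n\<close> is made once, on
  the carrier of the tensor algebra.\<close>

inductive_set relation_ideal :: "nat \<Rightarrow> (nat set fword \<Rightarrow>\<^sub>0 'f::field) set" for n where
  zero: "0 \<in> relation_ideal n"
| relation: "r \<in> Q_relations n \<Longrightarrow> a * r * b \<in> relation_ideal n"
| add: "p \<in> relation_ideal n \<Longrightarrow> q \<in> relation_ideal n \<Longrightarrow> p + q \<in> relation_ideal n"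

lemma relation_ideal_mult_left: "p \<in> relation_ideal n \<Longrightarrow> c * p \<in> relation_ideal n"
proof (induct p rule: relation_ideal.induct)
  case (relation r a b)
  then show ?case using relation_ideal.relation[OF relation, of "c * a" b] by (simp add: mult.assoc)
qed (auto simp: distrib_left intro: relation_ideal.intros)

lemma relation_ideal_mult_right: "p \<in> relation_ideal n \<Longrightarrow> p * c \<in> relation_ideal n"
proof (induct p rule: relation_ideal.induct)
  case (relation r a b)
  then show ?case using relation_ideal.relation[OF relation, of a "b * c"] by (simp add: mult.assoc)
qed (auto simp: distrib_right intro: relation_ideal.intros)

lemma relation_ideal_uminus: "p \<in> relation_ideal n \<Longrightarrow> - p \<in> relation_ideal n"
  using relation_ideal_mult_left[of p n "- 1"] by simp

lemma relation_ideal_diff: "p \<in> relation_ideal n \<Longrightarrow> q \<in> relation_ideal n \<Longrightarrow> p - q \<in> relation_ideal n"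
  using relation_ideal.add[OF _ relation_ideal_uminus] by fastforce

lemma relation_ideal_scl: "p \<in> relation_ideal n \<Longrightarrow> scl c p \<in> relation_ideal n"
  by (simp add: scl_conv_mult relation_ideal_mult_left)

lemma relation_ideal_relation: "r \<in> Q_relations n \<Longrightarrow> r \<in> relation_ideal n"
  using relation_ideal.relation[of r n 1 1] by simp

lemma subspace_relation_ideal: "scl.subspace (relation_ideal n)"
  by (intro scl.subspaceI relation_ideal.zero relation_ideal.add relation_ideal_scl)

lemma subst_relation_ideal:
  assumes "\<And>r. r \<in> Q_relations n \<Longrightarrow> subst g r \<in> relation_ideal m" "p \<in> relation_ideal n"
  shows "subst g p \<in> relation_ideal m"
  using assms(2)
proof (induct p rule: relation_ideal.induct)
  case (relation r a b)
  then show ?case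
    unfolding subst_mult
    by (intro relation_ideal_mult_right relation_ideal_mult_left assms(1))
qed (auto simp: subst_add intro: relation_ideal.intros)

section \<open>Modules over \<open>Q_algebra n\<close>\<close>

text \<open>The relation \<open>Q_relation B i j\<close> says that \<open>qsym V B (B - {i}) (B - {i, j})\<close> is symmetric
  in \<open>i\<close> and \<open>j\<close>; equivalently, so is the product of pseudo-roots
  \<open>(V B - V (B - {i})) (V (B - {i}) - V (B - {i, j}))\<close>.\<close>

definition qsym :: "(nat set \<Rightarrow> 'm \<Rightarrow> 'm) \<Rightarrow> nat set \<Rightarrow> nat set \<Rightarrow> nat set \<Rightarrow> 'm \<Rightarrow> 'm::ab_group_add" where
  "qsym V B C A m = V B (V C m) - V C (V C m) + V C (V A m)"

text \<open>The operators are total on the ambient space, but the relations are claimed only on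
  \<open>U\<close>. In the application \<open>U\<close> is the span of the normal words; splitting
  off a first block is inverse to attaching one only for well-formed words.\<close>

locale Q_module = free_rep s V
  for s :: "'f::field \<Rightarrow> 'm::ab_group_add \<Rightarrow> 'm" and V :: "nat set \<Rightarrow> 'm \<Rightarrow> 'm" +
  fixes U :: "'m set" and n :: nat
  assumes U_subspace: "subspace U"
    and V_closed: "m \<in> U \<Longrightarrow> V A m \<in> U"
    and V_empty [simp]: "V {} m = 0"
    and V_sym: "m \<in> U \<Longrightarrow> B \<subseteq> {1..n} \<Longrightarrow> i \<in> B \<Longrightarrow> j \<in> B \<Longrightarrow> i \<noteq> j \<Longrightarrow>
      qsym V B (B - {i}) (B - {i, j}) m = qsym V B (B - {j}) (B - {i, j}) m"
begin

lemma act_closed: "m \<in> U \<Longrightarrow> act s V p m \<in> U"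
  using act_in_subspace[OF U_subspace] V_closed by blast

lemma act_v [simp]: "act s V (v A) m = V A m"
  by (simp add: v_def)

lemma act_Q_relation:
  "act s V (Q_relation B i j) m =
     qsym V B (B - {i}) (B - {i, j}) m - qsym V B (B - {j}) (B - {i, j}) m"
  by (simp add: Q_relation_def qsym_def power2_eq_square act_add act_diff act_mult V_diff)

lemma act_relation_ideal:
  assumes "p \<in> relation_ideal n" "m \<in> U"
  shows "act s V p m = 0"
  using assms
proof (induct p rule: relation_ideal.induct)
  case (relation r a b)
  then have "act s V r (act s V b m) = 0"
    using V_sym[OF act_closed] by (auto simp: Q_relations_def act_Q_relation)
  then show ?case by (simp add: act_mult module_hom.zero[OF act_hom])
qed (simp_all add: act_add)

end

section \<open>Potentials on the Boolean lattice\<close>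

text \<open>A discrete path integral: \<open>f\<close> is a function on the edges of the Boolean
  lattice, summed along the path from \<open>B\<close> down to the empty set that always removes the
  maximum.\<close>

function pot :: "(nat set \<Rightarrow> nat set \<Rightarrow> 'g::ab_group_add) \<Rightarrow> nat set \<Rightarrow> 'g" where
  "pot f B = (if finite B \<and> B \<noteq> {} then pot f (B - {Max B}) + f B (B - {Max B}) else 0)"
  by pat_completeness auto
termination
  by (relation "measure (\<lambda>(f, B). card B)") (auto intro!: card_Diff1_less Max_in simp del: card_Diff_insert card_Diff_singleton)

declare pot.simps [simp del]

lemma pot_empty [simp]: "pot f {} = 0"
  by (simp add: pot.simps)

lemma pot_induct [consumes 1, case_names empty step]:
  assumes "finite B" "P {}"
    and "\<And>B. finite B \<Longrightarrow> B \<noteq> {} \<Longrightarrow> P (B - {Max B}) \<Longrightarrow> P B"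
  shows "P B"
  using assms(1)
proof (induct "card B" arbitrary: B rule: less_induct)
  case less
  show ?case
  proof (cases "B = {}")
    case False
    then have "card (B - {Max B}) < card B"
      using less.prems by (intro psubset_card_mono) (auto intro!: Max_in)
    then show ?thesis using less assms(3)[of B] False by simp
  qed (simp add: assms(2))
qed

text \<open>A discrete Poincare lemma: the hypothesis says that \<open>f\<close> has equal sums
  along both paths of every square, so its integral is independent of the path. The square spanned
  by \<open>i\<close> and the maximum of \<open>B\<close> reduces the claim to \<open>B\<close>
  without its maximum.\<close>

lemma pot_step:
  assumes "finite S"
    and "\<And>B i j. B \<subseteq> S \<Longrightarrow> i \<in> B \<Longrightarrow> j \<in> B \<Longrightarrow> i \<noteq> j \<Longrightarrow>
      f B (B - {i}) + f (B - {i}) (B - {i, j}) = f B (B - {j}) + f (B - {j}) (B - {i, j})"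
    and "B \<subseteq> S" "i \<in> B"
  shows "pot f B = pot f (B - {i}) + f B (B - {i})"
proof -
  have "finite B" using assms by (meson finite_subset)
  then show ?thesis
    using assms(3,4)
  proof (induct B arbitrary: i rule: pot_induct)
    case empty
    then show ?case by simp
  next
    case (step B)
    define m where "m = Max B"
    have m: "m \<in> B" and eq: "pot f B = pot f (B - {m}) + f B (B - {m})"
      using step(1,2) by (auto simp: m_def pot.simps[of f B] intro: Max_in)
    show ?case
    proof (cases "i = m")
      case True
      then show ?thesis using eq by simp
    next
      case False
      \<comment> \<open>Removing a different element leaves the maximum in place, so the recursion
        at \<open>B - {i}\<close> removes \<open>m\<close> as well and meets the other path at
        \<open>B - {i, m}\<close>.\<close>
      have "Max (B - {i}) = m"
        using step(1) m False by (intro Max_eqI) (auto simp: m_def)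
      then have 1: "pot f (B - {i}) = pot f (B - {i, m}) + f (B - {i}) (B - {i, m})"
        using step(1) m False by (subst pot.simps) (auto simp flip: Diff_insert2)
      have "B - {m} - {i} = B - {i, m}" by auto
      then have 2: "pot f (B - {m}) = pot f (B - {i, m}) + f (B - {m}) (B - {i, m})"
        using step(3)[of i] step(4,5) False by (auto simp: m_def)
      have 3: "f B (B - {i}) + f (B - {i}) (B - {i, m}) = f B (B - {m}) + f (B - {m}) (B - {i, m})"
        using assms(2)[of B i m] step(4,5) m False by simp
      show ?thesis
        unfolding eq 1 2 using arg_cong[OF 3, of "(+) (pot f (B - {i, m}))"] by (simp only: ac_simps)
    qed
  qed
qed

section \<open>The skew derivation\<close>

text \<open>The origin of the expression: let \<open>A = B - {i}\<close> and expand the relation for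
  \<open>insert (Suc n) B\<close> with the indices \<open>i\<close> and \<open>Suc n\<close> in
  terms of \<open>w\<close>, the \<open>v\<close> and the \<open>v'\<close>. The square of
  \<open>w\<close> and the products of \<open>w\<close> with \<open>v' A\<close> on its right
  cancel, and the relation says that \<open>w * (v B - v A) - (v' B - v' A) * w\<close> equals this
  expression.\<close>

definition skew_step ::
  "(nat set \<Rightarrow> 'm \<Rightarrow> 'm) \<Rightarrow> (nat set \<Rightarrow> 'm \<Rightarrow> 'm) \<Rightarrow> 'm \<Rightarrow> nat set \<Rightarrow> nat set \<Rightarrow> 'm::ab_group_add" where
  "skew_step X X' m B A =
     X' B (X' A m - X A m) - X' A (X' A m - X A m) - (X' B (X B m - X A m) - X B (X B m - X A m))"

definition nabla ::
  "(nat set \<Rightarrow> 'm \<Rightarrow> 'm) \<Rightarrow> (nat set \<Rightarrow> 'm \<Rightarrow> 'm) \<Rightarrow> nat set \<Rightarrow> 'm \<Rightarrow> 'm::ab_group_add" where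
  "nabla X X' B m = pot (skew_step X X' m) B"

text \<open>A skew derivation amounts to a homomorphism into upper triangular two-by-two matrices, so
  \<open>nabla\<close> extends from the generators to \<open>Q_algebra n\<close> once the \<open>twist\<close> operators satisfy its relations.\<close>

definition twist ::
  "(nat set \<Rightarrow> 'm \<Rightarrow> 'm) \<Rightarrow> (nat set \<Rightarrow> 'm \<Rightarrow> 'm) \<Rightarrow> nat set \<Rightarrow> 'm \<times> 'm \<Rightarrow> 'm \<times> 'm::ab_group_add" where
  "twist X X' A = (\<lambda>(x, y). (X' A x + nabla X X' A y, X A y))"

definition scale2 :: "('f \<Rightarrow> 'm \<Rightarrow> 'm) \<Rightarrow> 'f \<Rightarrow> 'm \<times> 'm \<Rightarrow> 'm \<times> 'm" where
  "scale2 s c = (\<lambda>(x, y). (s c x, s c y))"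

locale Q_module_pair = X: Q_module s X U n + X': Q_module s X' U n
  for s :: "'f::field \<Rightarrow> 'm::ab_group_add \<Rightarrow> 'm" and X X' U n
begin

lemmas additive = X.V_add X.V_diff X'.V_add X'.V_diff

lemma skew_step_add: "skew_step X X' (m + m') B A = skew_step X X' m B A + skew_step X X' m' B A"
  by (simp add: skew_step_def additive)

lemma skew_step_scale: "skew_step X X' (s c m) B A = s c (skew_step X X' m B A)"
  by (simp add: skew_step_def X.V_scale X'.V_scale additive X.scale_right_diff_distrib X.scale_right_distrib)

lemma skew_step_closed: "m \<in> U \<Longrightarrow> skew_step X X' m B A \<in> U"
  unfolding skew_step_def
  by (intro X.subspace_diff[OF X.U_subspace] X.V_closed X'.V_closed)

lemma nabla_linear: "Vector_Spaces.linear s s (nabla X X' B)"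
proof -
  have "nabla X X' B (m + m') = nabla X X' B m + nabla X X' B m' \<and>
      nabla X X' B (s c m) = s c (nabla X X' B m)" for m m' c
  proof (cases "finite B")
    case True
    then show ?thesis
      by (induct B rule: pot_induct)
        (simp_all add: nabla_def pot.simps[of _ B for B] skew_step_add skew_step_scale X.scale_right_distrib)
  qed (simp add: nabla_def pot.simps)
  then show ?thesis
    by (intro Vector_Spaces.linear.intro module_hom.intro module_hom_axioms.intro
        X.vector_space_axioms X.module_axioms) auto
qed

lemma nabla_closed: "m \<in> U \<Longrightarrow> nabla X X' B m \<in> U"
proof (cases "finite B")
  case True
  then show "m \<in> U \<Longrightarrow> ?thesis"
    by (induct B rule: pot_induct)
      (simp_all add: nabla_def pot.simps[of _ B for B] X.subspace_0[OF X.U_subspace]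
        X.subspace_add[OF X.U_subspace] skew_step_closed)
qed (simp add: nabla_def pot.simps X.subspace_0[OF X.U_subspace])

text \<open>The terms are regrouped so that the middle set \<open>C\<close> occurs only inside
  \<open>qsym\<close>. Hence the sum along a path of length two is independent of the path as soon
  as both copies satisfy the relations.\<close>

lemma skew_step_path:
  "skew_step X X' m B C + skew_step X X' m C A =
     qsym X' B C A m - qsym X B C A m - X' B (X B m) + X B (X B m) - X' A (X' A m) + X' A (X A m)"
  by (simp add: skew_step_def qsym_def additive algebra_simps)

lemma nabla_step:
  assumes "m \<in> U" "B \<subseteq> {1..n}" "i \<in> B"
  shows "nabla X X' B m = nabla X X' (B - {i}) m + skew_step X X' m B (B - {i})"
  unfolding nabla_def
proof (rule pot_step[OF _ _ assms(2,3)])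
  fix B i j assume "B \<subseteq> {1..n}" "i \<in> B" "j \<in> B" "i \<noteq> j"
  with assms(1) show "skew_step X X' m B (B - {i}) + skew_step X X' m (B - {i}) (B - {i, j}) =
      skew_step X X' m B (B - {j}) + skew_step X X' m (B - {j}) (B - {i, j})"
    unfolding skew_step_path using X.V_sym[of m B i j] X'.V_sym[of m B i j] by simp
qed simp

text \<open>The left side collects the edge contributions that the Leibniz rule yields for
  \<open>nabla\<close> of a relation. On the right the middle set \<open>C\<close> again occurs only
  inside \<open>qsym\<close>, now at \<open>m\<close>, \<open>X A m\<close> and
  \<open>X' A m - X A m\<close>, or with a further operator applied outside.\<close>

lemma nabla_sym_aux:
  "X' B (skew_step X X' m C A) - X' C (skew_step X X' m C A) + skew_step X X' (X C m) B C +
     skew_step X X' (X A m) C A =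
   qsym X' B C A (X' A m - X A m) - X' B (X' A (X' A m - X A m)) - X' B (qsym X B C A m) +
   X B (qsym X B C A m) + X' B (X B (X A m)) - X B (X B (X A m)) + qsym X' B C A (X A m) -
   qsym X B C A (X A m) - X' B (X B (X A m)) + X B (X B (X A m)) - X' A (X' A (X A m)) +
   X' A (X A (X A m))"
  by (simp add: skew_step_def qsym_def additive algebra_simps)

text \<open>The second coordinate is the relation for \<open>X\<close>. In the first,
  \<open>nabla\<close> at \<open>B\<close> and at the middle set is expressed by
  \<open>nabla\<close> at the bottom set plus edge values; what still depends on the middle set is a
  \<open>qsym\<close> of \<open>X'\<close> and the sum regrouped in
  \<open>nabla_sym_aux\<close>.\<close>

lemma twist_module: "Q_module (scale2 s) (twist X X') (U \<times> U) n"
proof -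
  have vs: "vector_space (scale2 s)"
    by standard (auto simp: scale2_def X.scale_right_distrib X.scale_left_distrib)
  interpret S: vector_space "scale2 s" by (rule vs)
  note nabla_add = module_hom.add[OF Vector_Spaces.linear.axioms(3)[OF nabla_linear]]
  note nabla_scale = module_hom.scale[OF Vector_Spaces.linear.axioms(3)[OF nabla_linear]]
  show ?thesis
  proof (unfold_locales)
    show "twist X X' A (p + q) = twist X X' A p + twist X X' A q"
      and "twist X X' A (scale2 s c p) = scale2 s c (twist X X' A p)" for A p q c
      by (auto simp: twist_def scale2_def additive nabla_add nabla_scale X.V_scale X'.V_scale
          X.scale_right_distrib split: prod.splits)
    show "S.subspace (U \<times> U)"
      by (rule S.subspaceI) (auto simp: scale2_def X.subspace_0[OF X.U_subspace] zero_prod_def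
          X.subspace_add[OF X.U_subspace] X.subspace_scale[OF X.U_subspace])
    show "twist X X' A p \<in> U \<times> U" if "p \<in> U \<times> U" for A p
      using that by (auto simp: twist_def X.V_closed X'.V_closed nabla_closed X.subspace_add[OF X.U_subspace])
    show "twist X X' {} p = 0" for p
      by (cases p) (simp add: twist_def nabla_def zero_prod_def)
  next
    fix p B and i j :: nat
    assume p: "p \<in> U \<times> U" and B: "B \<subseteq> {1..n}" "i \<in> B" "j \<in> B" "i \<noteq> j"
    obtain x y where xy: "p = (x, y)" "x \<in> U" "y \<in> U" using p by auto
    let ?N = "nabla X X'" and ?A = "B - {i, j}"
    have *: "qsym (twist X X') B C ?A (x, y) =
        (qsym X' B C ?A x + X' B (?N ?A y) + ?N ?A (X ?A y) +
           (X' B (skew_step X X' y C ?A) - X' C (skew_step X X' y C ?A) +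
            skew_step X X' (X C y) B C + skew_step X X' (X ?A y) C ?A),
         qsym X B C ?A y)"
      if k: "k \<in> {i, j}" "C = B - {k}" for k C
    proof -
      obtain l where l: "l \<in> C" "?A = C - {l}" using B k by (cases "k = i") auto
      have C: "C \<subseteq> {1..n}" using B k by auto
      have 1: "?N C y = ?N ?A y + skew_step X X' y C ?A"
        using nabla_step[OF xy(3) C l(1)] l(2) by simp
      have 2: "?N B (X C y) = ?N C (X C y) + skew_step X X' (X C y) B C"
        using nabla_step[OF X.V_closed[OF xy(3)] B(1), of k C] k B by auto
      have 3: "?N C (X ?A y) = ?N ?A (X ?A y) + skew_step X X' (X ?A y) C ?A"
        using nabla_step[OF X.V_closed[OF xy(3)] C l(1), of ?A] l(2) by simp
      show ?thesis
        unfolding qsym_def twist_def by (simp add: 1 2 3 additive)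
    qed
    have sx: "qsym X' B (B - {i}) ?A z = qsym X' B (B - {j}) ?A z"
      and sy: "qsym X B (B - {i}) ?A z = qsym X B (B - {j}) ?A z" if "z \<in> U" for z
      using X.V_sym[OF that B] X'.V_sym[OF that B] by auto
    have U: "X ?A y \<in> U" "X' ?A y - X ?A y \<in> U"
      using xy by (auto intro!: X.subspace_diff[OF X.U_subspace] X.V_closed X'.V_closed)
    show "qsym (twist X X') B (B - {i}) ?A p = qsym (twist X X') B (B - {j}) ?A p"
      unfolding xy(1) *[OF insertI1 refl] *[OF insertI2[OF insertI1] refl] nabla_sym_aux
      by (simp add: sx[OF xy(2)] sx[OF U(1)] sx[OF U(2)] sy[OF xy(3)] sy[OF U(1)])
  qed
qed

end

section \<open>Normal words\<close>

text \<open>A list of blocks encodes a normal word of \<open>Q_algebra (Suc n)\<close>: \<open>Gen\<close> stands for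
  \<open>v {Suc n}\<close>, and \<open>Block b c\<close> for the normal word \<open>c\<close> of \<open>Q_algebra n\<close>, read in the copy of
  \<open>Q_algebra n\<close> generated by the \<open>v A\<close> if \<open>b\<close> is false, and by the \<open>v (insert (Suc n) A) - v {Suc n}\<close>
  if \<open>b\<close> is true.\<close>

datatype block = Gen | Block bool "block list"

fun block_degree :: "block \<Rightarrow> nat" where
  "block_degree Gen = 1"
| "block_degree (Block b c) = sum_list (map block_degree c)"

definition word_degree :: "block list \<Rightarrow> nat" where
  "word_degree u = sum_list (map block_degree u)"

fun starts :: "bool \<Rightarrow> block list \<Rightarrow> bool" where
  "starts b (Block b' c # t) = (b = b')"
| "starts b t = False"

text \<open>\<open>Gen\<close> followed by a block of the first copy is excluded because the
  commutation rule rewrites it. Adjacent blocks of the same copy are excluded because they multiply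
  within that copy of \<open>Q_algebra n\<close>.\<close>

fun admissible :: "block list set \<Rightarrow> block list \<Rightarrow> bool" where
  "admissible C [] = True"
| "admissible C (Gen # t) = (admissible C t \<and> \<not> starts False t)"
| "admissible C (Block b c # t) = (admissible C t \<and> \<not> starts b t \<and> c \<in> C \<and> c \<noteq> [])"

primrec normal_words :: "nat \<Rightarrow> block list set" where
  "normal_words 0 = {[]}"
| "normal_words (Suc n) = {u. admissible (normal_words n) u}"

definition attach :: "bool \<Rightarrow> block list \<Rightarrow> block list \<Rightarrow> block list" where
  "attach b c t = (if c = [] then t else Block b c # t)"

fun split_word :: "bool \<Rightarrow> block list \<Rightarrow> block list \<times> block list" where
  "split_word b (Block b' c # t) = (if b = b' then (c, t) else ([], Block b' c # t))"
| "split_word b t = ([], t)"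

lemma attach_Nil [simp]: "attach b [] t = t"
  by (simp add: attach_def)

lemma split_attach [simp]: "\<not> starts b t \<Longrightarrow> split_word b (attach b c t) = (c, t)"
  by (cases "(b, t)" rule: starts.cases) (auto simp: attach_def)

lemma Nil_normal_words [simp]: "[] \<in> normal_words n"
  by (cases n) auto

lemma attach_normal_words:
  "c \<in> normal_words n \<Longrightarrow> t \<in> normal_words (Suc n) \<Longrightarrow> \<not> starts b t \<Longrightarrow>
    attach b c t \<in> normal_words (Suc n)"
  by (auto simp: attach_def)

text \<open>The combinatorial form of freeness: over either copy of \<open>Q_algebra n\<close>, the
  basis consists of the normal words \<open>t\<close> that do not start in that copy. The factor
  \<open>c\<close> may be empty.\<close>

lemma normal_words_attach_cases:
  assumes "u \<in> normal_words (Suc n)"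
  obtains c t where "u = attach b c t" "c \<in> normal_words n" "t \<in> normal_words (Suc n)" "\<not> starts b t"
proof (cases "starts b u")
  case True
  then obtain c t where u: "u = Block b c # t" by (cases "(b, u)" rule: starts.cases) auto
  with assms show ?thesis by (intro that[of c t]) (auto simp: attach_def)
next
  case False
  with assms show ?thesis by (intro that[of "[]" u]) auto
qed

text \<open>Subtracting \<open>v {Suc n}\<close> makes the primed letter of the empty set vanish, as
  the convention \<open>v {} = 0\<close> requires.\<close>

definition copy :: "nat \<Rightarrow> bool \<Rightarrow> nat set \<Rightarrow> nat set fword \<Rightarrow>\<^sub>0 'f::field" where
  "copy n b A = (if b then v (insert (Suc n) A) - v {Suc n} else v A)"

primrec monomial :: "nat \<Rightarrow> block list \<Rightarrow> nat set fword \<Rightarrow>\<^sub>0 'f::field" where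
  "monomial 0 u = 1"
| "monomial (Suc n) u =
     prod_list (map (\<lambda>x. case x of Gen \<Rightarrow> v {Suc n} | Block b c \<Rightarrow> subst (copy n b) (monomial n c)) u)"

lemma monomial_Nil [simp]: "monomial n [] = 1"
  by (cases n) auto

lemma monomial_attach: "monomial (Suc n) (attach b c t) = subst (copy n b) (monomial n c) * monomial (Suc n) t"
  by (simp add: attach_def)

lemma monomial_Gen: "monomial (Suc n) (Gen # t) = v {Suc n} * monomial (Suc n) t"
  by simp

subsection \<open>Degrees\<close>

lemma tensor_power_mult:
  assumes "p \<in> tensor_power X i" "q \<in> tensor_power X j"
  shows "p * q \<in> tensor_power X (i + j)"
proof -
  have "set (letters w) \<subseteq> X \<and> length (letters w) = i + j" if "w \<in> Poly_Mapping.keys (p * q)" for w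
    using subsetD[OF keys_mult that] assms
    by (fastforce simp: tensor_power_def tensor_algebra_def plus_fword_def)
  then show ?thesis by (auto simp: tensor_power_def tensor_algebra_def)
qed

lemma tensor_power_one: "1 \<in> tensor_power X 0"
  by (simp add: tensor_power_def tensor_algebra_def zero_fword_def)

lemma subspace_tensor_power: "scl.subspace (tensor_power X i :: ('x fword \<Rightarrow>\<^sub>0 'f::field) set)"
proof (rule scl.subspaceI)
  fix p q :: "'x fword \<Rightarrow>\<^sub>0 'f"
  show "p + q \<in> tensor_power X i" if "p \<in> tensor_power X i" "q \<in> tensor_power X i"
    using that keys_add[of p q] by (fastforce simp: tensor_power_def tensor_algebra_def)
  show "scl c p \<in> tensor_power X i" if "p \<in> tensor_power X i" for c
    using that keys_scl[of c p] by (fastforce simp: tensor_power_def tensor_algebra_def)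
qed (simp add: tensor_power_def tensor_algebra_def)

lemma subst_tensor_power:
  assumes "\<And>x. x \<in> X \<Longrightarrow> g x \<in> tensor_power Y 1" "p \<in> tensor_power X i"
  shows "subst g p \<in> tensor_power Y i"
  unfolding subst_def act_def
proof (rule scl.ext_in_subspace[OF subspace_tensor_power])
  have "foldr (\<lambda>x. (*) (g x)) xs 1 \<in> tensor_power Y (length xs)" if "set xs \<subseteq> X" for xs
    using that by (induct xs) (use tensor_power_mult[OF assms(1)] tensor_power_one in auto)
  then show "foldr (\<lambda>x. (*) (g x)) (letters w) 1 \<in> tensor_power Y i" if "w \<in> Poly_Mapping.keys p" for w
    using that assms(2) by (force simp: tensor_power_def tensor_algebra_def)
qed

lemma v_tensor_power: "A \<subseteq> {1..n} \<Longrightarrow> v A \<in> tensor_power (Q_basis n) 1"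
  by (auto simp: v_def tensor_power_def tensor_algebra_def Q_basis_def)

lemma copy_tensor_power: "A \<subseteq> {1..n} \<Longrightarrow> copy n b A \<in> tensor_power (Q_basis (Suc n)) 1"
proof -
  assume "A \<subseteq> {1..n}"
  then have "A \<subseteq> {1..Suc n}" by fastforce
  then show ?thesis
    unfolding copy_def
    by (cases b) (simp_all add: scl.subspace_diff[OF subspace_tensor_power] v_tensor_power
        del: One_nat_def)
qed

lemma monomial_tensor_power:
  "u \<in> normal_words n \<Longrightarrow>
    (monomial n u :: nat set fword \<Rightarrow>\<^sub>0 'f::field) \<in> tensor_power (Q_basis n) (word_degree u)"
proof (induct n arbitrary: u)
  case 0
  then show ?case by (simp add: tensor_power_one word_degree_def)
next
  case (Suc n)
  from Suc.prems have "admissible (normal_words n) u" by simp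
  then show ?case
  proof (induct "normal_words n" u rule: admissible.induct)
    case 1
    then show ?case by (simp add: tensor_power_one word_degree_def)
  next
    case (2 t)
    then show ?case
      using tensor_power_mult[OF v_tensor_power[of "{Suc n}" "Suc n"]] by (simp add: word_degree_def)
  next
    case (3 b c t)
    have "subst (copy n b) (monomial n c :: nat set fword \<Rightarrow>\<^sub>0 'f) \<in>
        tensor_power (Q_basis (Suc n)) (word_degree c)"
      using 3 by (intro subst_tensor_power[of "Q_basis n"] copy_tensor_power Suc.hyps) (auto simp: Q_basis_def)
    from tensor_power_mult[OF this] show ?case using 3 by (simp add: word_degree_def)
  qed
qed

lemma monomial_letters:
  assumes "u \<in> normal_words n" "w \<in> Poly_Mapping.keys (monomial n u :: nat set fword \<Rightarrow>\<^sub>0 'f::field)"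
    "A \<in> set (letters w)"
  shows "A \<in> Q_basis n"
  using monomial_tensor_power[OF assms(1), where 'f = 'f] assms(2,3)
  by (auto simp: tensor_power_def tensor_algebra_def)

section \<open>The regular representation\<close>

abbreviation basis_vec :: "'k \<Rightarrow> 'k \<Rightarrow>\<^sub>0 'f::field" where
  "basis_vec u \<equiv> Poly_Mapping.single u 1"

definition supported :: "'k set \<Rightarrow> ('k \<Rightarrow>\<^sub>0 'f::field) set" where
  "supported B = {p. Poly_Mapping.keys p \<subseteq> B}"

lemma subspace_supported: "scl.subspace (supported B :: ('k \<Rightarrow>\<^sub>0 'f::field) set)"
proof (rule scl.subspaceI)
  fix p q :: "'k \<Rightarrow>\<^sub>0 'f"
  show "p + q \<in> supported B" if "p \<in> supported B" "q \<in> supported B"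
    using that keys_add[of p q] by (auto simp: supported_def)
  show "scl c p \<in> supported B" if "p \<in> supported B" for c
    using that keys_scl[of c p] by (auto simp: supported_def)
qed (simp add: supported_def)

lemma basis_vec_supported [simp]: "basis_vec u \<in> supported B \<longleftrightarrow> u \<in> B"
  by (simp add: supported_def)

text \<open>For fixed \<open>t\<close> this identifies the module of level \<open>n\<close> with the
  summand of words \<open>c t\<close>, the letters of \<open>c\<close> being read in the copy
  \<open>b\<close>.\<close>

definition joins :: "bool \<Rightarrow> block list \<Rightarrow> (block list \<Rightarrow>\<^sub>0 'f::field) \<Rightarrow> block list \<Rightarrow>\<^sub>0 'f" where
  "joins b t = ext scl (\<lambda>c. basis_vec (attach b c t))"

definition side ::
  "bool \<Rightarrow> (nat set \<Rightarrow> block list \<Rightarrow> (block list \<Rightarrow>\<^sub>0 'f::field)) \<Rightarrow> nat set \<Rightarrow> block list \<Rightarrow> (block list \<Rightarrow>\<^sub>0 'f)" where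
  "side b F A u = (case split_word b u of (c, t) \<Rightarrow> joins b t (F A c))"

definition side_op ::
  "bool \<Rightarrow> (nat set \<Rightarrow> block list \<Rightarrow> (block list \<Rightarrow>\<^sub>0 'f::field)) \<Rightarrow> nat set \<Rightarrow>
    (block list \<Rightarrow>\<^sub>0 'f) \<Rightarrow> (block list \<Rightarrow>\<^sub>0 'f)" where
  "side_op b F A = ext scl (side b F A)"

text \<open>Left multiplication by \<open>w = v {Suc n}\<close>, from the commutation rule
  \<open>w * x = x' * w + nabla x\<close>, where \<open>x\<close> and \<open>x'\<close> correspond in the two copies of \<open>Q_algebra n\<close>.\<close>

definition gen_op ::
  "nat \<Rightarrow> (nat set \<Rightarrow> block list \<Rightarrow> (block list \<Rightarrow>\<^sub>0 'f::field)) \<Rightarrow> block list \<Rightarrow> (block list \<Rightarrow>\<^sub>0 'f)" where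
  "gen_op n F u = (case split_word False u of (q, t) \<Rightarrow>
     basis_vec (attach True q (Gen # t)) +
       fst (act (scale2 scl) (twist (side_op False F) (side_op True F)) (monomial n q) (0, basis_vec t)))"

definition step_op ::
  "nat \<Rightarrow> (nat set \<Rightarrow> block list \<Rightarrow> (block list \<Rightarrow>\<^sub>0 'f::field)) \<Rightarrow> nat set \<Rightarrow> block list \<Rightarrow> (block list \<Rightarrow>\<^sub>0 'f)" where
  "step_op n F A u =
     (if Suc n \<in> A then side True F (A - {Suc n}) u + gen_op n F u else side False F A u)"

primrec left_mult :: "nat \<Rightarrow> nat set \<Rightarrow> block list \<Rightarrow> (block list \<Rightarrow>\<^sub>0 'f::field)" where
  "left_mult 0 = (\<lambda>A u. 0)"
| "left_mult (Suc n) = step_op n (left_mult n)"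

lemma linear_add:
  assumes "Vector_Spaces.linear s1 s2 f" "Vector_Spaces.linear s1 s2 g"
  shows "Vector_Spaces.linear s1 s2 (\<lambda>x. f x + g x)"
proof -
  interpret f: Vector_Spaces.linear s1 s2 f by fact
  interpret g: Vector_Spaces.linear s1 s2 g by fact
  show ?thesis
    by unfold_locales (simp_all add: f.add g.add f.scale g.scale f.vs2.scale_right_distrib)
qed

lemma qsym_linear:
  assumes "free_rep s V"
  shows "Vector_Spaces.linear s s (qsym V B C A)"
proof -
  interpret free_rep s V by fact
  show ?thesis
    by (intro Vector_Spaces.linear.intro module_hom.intro module_hom_axioms.intro
        vector_space_axioms module_axioms)
      (simp_all add: qsym_def V_add V_scale scale_right_distrib scale_right_diff_distrib)
qed

text \<open>The action is upper triangular with diagonal entries \<open>X'\<close> and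
  \<open>X\<close>. The second coordinate is what the term \<open>nabla a * p\<close> of the Leibniz
  rule for \<open>nabla (a * p)\<close> acts through.\<close>

lemma (in Q_module_pair) snd_act_twist:
  "snd (act (scale2 s) (twist X X') p (x, y)) = act s X p y"
proof -
  interpret T: Q_module "scale2 s" "twist X X'" "U \<times> U" n by (rule twist_module)
  have "snd (foldr (twist X X') xs (x, y)) = foldr X xs y" for xs
    by (induct xs) (auto simp: twist_def split: prod.splits)
  moreover have "snd (scale2 s c z) = s c (snd z)" for c z
    by (simp add: scale2_def split: prod.splits)
  ultimately show ?thesis
    unfolding act_def ext_def snd_sum by simp
qed

text \<open>The induction hypothesis. \<open>act_monomial\<close> gives independence of the normal
  words modulo the relations. \<open>monomial_cong\<close> gives that they span, and it makes the
  lifts used in \<open>gen_op\<close> compatible with left multiplication.\<close>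

locale Q_level = Q_module scl "\<lambda>A. ext scl (F A)" "supported (normal_words n)" n
  for n :: nat and F :: "nat set \<Rightarrow> block list \<Rightarrow> (block list \<Rightarrow>\<^sub>0 'f::field)" +
  assumes act_monomial:
      "u \<in> normal_words n \<Longrightarrow> act scl (\<lambda>A. ext scl (F A)) (monomial n u) (basis_vec []) = basis_vec u"
    and monomial_cong:
      "u \<in> normal_words n \<Longrightarrow> A \<subseteq> {1..n} \<Longrightarrow>
        ext scl (monomial n) (F A u) - v A * monomial n u \<in> relation_ideal n"
begin

lemma joins_linear: "Vector_Spaces.linear scl scl (joins b t)"
  unfolding joins_def by (rule scl.ext_linear)

lemmas joins_hom = Vector_Spaces.linear.axioms(3)[OF joins_linear]
lemmas joins_add = module_hom.add[OF joins_hom]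
lemmas joins_diff = module_hom.diff[OF joins_hom]

lemma joins_basis [simp]: "joins b t (basis_vec c) = basis_vec (attach b c t)"
  by (simp add: joins_def)

lemma F_empty: "F {} u = 0"
  using V_empty[of "basis_vec u"] by simp

lemma F_closed: "u \<in> normal_words n \<Longrightarrow> F A u \<in> supported (normal_words n)"
  using V_closed[of "basis_vec u" A] by simp

lemma side_attach: "\<not> starts b t \<Longrightarrow> side b F A (attach b c t) = joins b t (F A c)"
  by (simp add: side_def)

lemma side_op_joins:
  assumes "\<not> starts b t"
  shows "side_op b F A (joins b t p) = joins b t (ext scl (F A) p)"
proof (rule scl.linear_eq_on_basis[where g = "\<lambda>p. side_op b F A (joins b t p)"])
  show "Vector_Spaces.linear scl scl (\<lambda>p. side_op b F A (joins b t p))"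
    using Vector_Spaces.linear_compose[OF joins_linear scl.ext_linear] by (simp add: o_def side_op_def)
  show "Vector_Spaces.linear scl scl (\<lambda>p. joins b t (ext scl (F A) p))"
    using Vector_Spaces.linear_compose[OF scl.ext_linear joins_linear] by (simp add: o_def)
qed (simp add: side_op_def side_attach assms)

lemma joins_closed:
  assumes "p \<in> supported (normal_words n)" "t \<in> normal_words (Suc n)" "\<not> starts b t"
  shows "joins b t p \<in> supported (normal_words (Suc n))"
  unfolding joins_def using assms
  by (intro scl.ext_in_subspace[OF subspace_supported])
    (auto simp: supported_def simp del: normal_words.simps intro!: attach_normal_words)

lemma linear_eq_on_normal_words:
  assumes "Vector_Spaces.linear scl s g" "Vector_Spaces.linear scl s h"
    "m \<in> supported (normal_words (Suc n))"
    "\<And>c t. c \<in> normal_words n \<Longrightarrow> t \<in> normal_words (Suc n) \<Longrightarrow> \<not> starts b t \<Longrightarrow>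
       g (basis_vec (attach b c t)) = h (basis_vec (attach b c t))"
  shows "g m = h m"
proof (rule vector_space.linear_eq_on_basis[OF _ assms(1,2)])
  show "vector_space s" using assms(1) by (simp add: Vector_Spaces.linear_def)
  fix u assume "u \<in> Poly_Mapping.keys m"
  then have "u \<in> normal_words (Suc n)" using assms(3) by (auto simp: supported_def)
  then obtain c t where "u = attach b c t" "c \<in> normal_words n" "t \<in> normal_words (Suc n)" "\<not> starts b t"
    by (rule normal_words_attach_cases)
  then show "g (basis_vec u) = h (basis_vec u)"
    using assms(4) by blast
qed

text \<open>For each \<open>t\<close> not starting with \<open>b\<close>, the words
  \<open>attach b c t\<close> span an isomorphic image of the level \<open>n\<close> module, so the
  relations are inherited summand by summand.\<close>

lemma side_module: "Q_module scl (side_op b F) (supported (normal_words (Suc n))) n"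
proof -
  have lin: "Vector_Spaces.linear scl scl (side_op b F A)" for A
    unfolding side_op_def by (rule scl.ext_linear)
  interpret R: free_rep scl "side_op b F"
    by (intro free_rep.intro free_rep_axioms.intro scl.vector_space_axioms lin)
  show ?thesis
  proof (intro Q_module.intro Q_module_axioms.intro R.free_rep_axioms subspace_supported)
    fix A and m :: "block list \<Rightarrow>\<^sub>0 'f"
    assume m: "m \<in> supported (normal_words (Suc n))"
    show "side_op b F A m \<in> supported (normal_words (Suc n))"
      unfolding side_op_def
    proof (rule scl.ext_in_subspace[OF subspace_supported])
      fix u assume "u \<in> Poly_Mapping.keys m"
      then have "u \<in> normal_words (Suc n)" using m by (auto simp: supported_def)
      then obtain c t where "u = attach b c t" "c \<in> normal_words n" "t \<in> normal_words (Suc n)" "\<not> starts b t"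
        by (rule normal_words_attach_cases)
      then show "side b F A u \<in> supported (normal_words (Suc n))"
        by (simp add: side_attach joins_closed F_closed del: normal_words.simps)
    qed
  next
    fix m
    have "side b F {} u = 0" for u
      by (simp add: side_def F_empty module_hom.zero[OF joins_hom] split: prod.splits)
    then show "side_op b F {} m = 0" by (simp add: side_op_def ext_def)
  next
    fix B i j and m :: "block list \<Rightarrow>\<^sub>0 'f"
    assume m: "m \<in> supported (normal_words (Suc n))" and B: "B \<subseteq> {1..n}" "i \<in> B" "j \<in> B" "i \<noteq> j"
    show "qsym (side_op b F) B (B - {i}) (B - {i, j}) m = qsym (side_op b F) B (B - {j}) (B - {i, j}) m"
    proof (rule linear_eq_on_normal_words[OF qsym_linear qsym_linear m, OF R.free_rep_axioms R.free_rep_axioms])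
      fix c t assume ct: "c \<in> normal_words n" "\<not> starts b t"
      have "qsym (side_op b F) B C A (joins b t p) = joins b t (qsym (\<lambda>A. ext scl (F A)) B C A p)" for C A p
        by (simp add: qsym_def side_op_joins[OF ct(2)] joins_add joins_diff)
      from this[of _ _ "basis_vec c"] show "qsym (side_op b F) B (B - {i}) (B - {i, j}) (basis_vec (attach b c t)) =
          qsym (side_op b F) B (B - {j}) (B - {i, j}) (basis_vec (attach b c t))"
        using V_sym[of "basis_vec c" B i j] ct(1) B by simp
    qed
  qed
qed

sublocale pair: Q_module_pair scl "side_op False F" "side_op True F" "supported (normal_words (Suc n))" n
  by (intro Q_module_pair.intro side_module)

sublocale tw: Q_module "scale2 scl" "twist (side_op False F) (side_op True F)"
  "supported (normal_words (Suc n)) \<times> supported (normal_words (Suc n))" n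
  by (rule pair.twist_module)

lemma act_side_joins:
  assumes "\<not> starts b t"
  shows "act scl (side_op b F) p (joins b t q) = joins b t (act scl (\<lambda>A. ext scl (F A)) p q)"
proof -
  have *: "foldr (side_op b F) xs (joins b t q) = joins b t (foldr (\<lambda>A. ext scl (F A)) xs q)" for xs
    by (induct xs) (simp_all add: side_op_joins[OF assms])
  show ?thesis
    by (simp add: act_def ext_def module_hom.sum[OF joins_hom] module_hom.scale[OF joins_hom] *)
qed

lemma act_side_monomial:
  assumes "c \<in> normal_words n" "\<not> starts b t"
  shows "act scl (side_op b F) (monomial n c) (basis_vec t) = basis_vec (attach b c t)"
  using act_side_joins[OF assms(2), of "monomial n c" "basis_vec []"] act_monomial[OF assms(1)] by simp

abbreviation "twisted \<equiv> act (scale2 scl) (twist (side_op False F) (side_op True F))"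

text \<open>\<open>F A q\<close> expresses the product of \<open>v A\<close> and the word
  \<open>q\<close> in normal words. Its lift differs from \<open>v A * monomial n q\<close> by an
  element of the relation ideal, and the twisted module kills that element.\<close>

lemma twisted_F:
  assumes "q \<in> normal_words n" "A \<subseteq> {1..n}" "t \<in> normal_words (Suc n)"
  shows "ext (scale2 scl) (\<lambda>q. twisted (monomial n q) (0, basis_vec t)) (F A q) =
    twist (side_op False F) (side_op True F) A (twisted (monomial n q) (0, basis_vec t))"
proof -
  let ?m = "(0, basis_vec t) :: (block list \<Rightarrow>\<^sub>0 'f) \<times> (block list \<Rightarrow>\<^sub>0 'f)"
  have m: "?m \<in> supported (normal_words (Suc n)) \<times> supported (normal_words (Suc n))"
    using assms(3) scl.subspace_0[OF subspace_supported] by auto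
  have "ext (scale2 scl) (\<lambda>q. twisted (monomial n q) ?m) (F A q) =
      twisted (ext scl (monomial n) (F A q)) ?m"
  proof (rule tw.linear_eq_on_basis[OF tw.ext_linear])
    show "Vector_Spaces.linear scl (scale2 scl) (\<lambda>p. twisted (ext scl (monomial n) p) ?m)"
      using Vector_Spaces.linear_compose[OF scl.ext_linear tw.act_linear] by (simp add: o_def)
  qed simp
  also have "\<dots> = twisted (v A * monomial n q) ?m"
    using tw.act_relation_ideal[OF monomial_cong[OF assms(1,2)] m] by (simp add: tw.act_diff)
  finally show ?thesis by (simp add: tw.act_mult)
qed

abbreviation "Om \<equiv> ext scl (gen_op n F)"

lemma gen_op_attach:
  assumes "\<not> starts False t"
  shows "gen_op n F (attach False q t) =
    basis_vec (attach True q (Gen # t)) + fst (twisted (monomial n q) (0, basis_vec t))"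
  using assms by (simp add: gen_op_def)

lemma Om_joins:
  assumes "\<not> starts False t"
  shows "Om (joins False t p) = joins True (Gen # t) p +
    fst (ext (scale2 scl) (\<lambda>q. twisted (monomial n q) (0, basis_vec t)) p)"
proof (rule scl.linear_eq_on_basis[where g = "\<lambda>p. Om (joins False t p)"])
  show "Vector_Spaces.linear scl scl (\<lambda>p. Om (joins False t p))"
    using Vector_Spaces.linear_compose[OF joins_linear scl.ext_linear] by (simp add: o_def)
  show "Vector_Spaces.linear scl scl (\<lambda>p. joins True (Gen # t) p +
      fst (ext (scale2 scl) (\<lambda>q. twisted (monomial n q) (0, basis_vec t)) p))"
    by (intro Vector_Spaces.linear.intro module_hom.intro module_hom_axioms.intro
        scl.vector_space_axioms scl.module_axioms)
      (simp_all add: joins_add tw.ext_add tw.ext_scl module_hom.scale[OF joins_hom] scl.scale_right_distrib,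
        simp add: scale2_def split: prod.splits)
next
  fix k show "Om (joins False t (basis_vec k)) = joins True (Gen # t) (basis_vec k) +
      fst (ext (scale2 scl) (\<lambda>q. twisted (monomial n q) (0, basis_vec t)) (basis_vec k))"
    by (simp add: gen_op_attach[OF assms])
qed

lemma twisted_closed:
  assumes "t \<in> normal_words (Suc n)"
  shows "fst (twisted p (0, basis_vec t)) \<in> supported (normal_words (Suc n))"
proof -
  have "twisted p (0, basis_vec t) \<in> supported (normal_words (Suc n)) \<times> supported (normal_words (Suc n))"
    using assms scl.subspace_0[OF subspace_supported] by (intro tw.act_closed) auto
  then show ?thesis by auto
qed

lemma Om_closed:
  assumes "m \<in> supported (normal_words (Suc n))"
  shows "Om m \<in> supported (normal_words (Suc n))"
proof (rule scl.ext_in_subspace[OF subspace_supported])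
  fix u assume "u \<in> Poly_Mapping.keys m"
  then have "u \<in> normal_words (Suc n)" using assms by (auto simp: supported_def)
  then obtain q t where u: "u = attach False q t" "q \<in> normal_words n" "t \<in> normal_words (Suc n)" "\<not> starts False t"
    by (rule normal_words_attach_cases)
  moreover have "attach True q (Gen # t) \<in> normal_words (Suc n)"
    using u by (intro attach_normal_words) auto
  ultimately show "gen_op n F u \<in> supported (normal_words (Suc n))"
    by (simp add: gen_op_attach twisted_closed scl.subspace_add[OF subspace_supported] del: normal_words.simps)
qed

text \<open>The commutation rule \<open>w * x = x' * w + nabla x\<close> for operators. On a word
  \<open>q t\<close> it follows from the Leibniz rule for \<open>v A\<close> times the lift of
  \<open>q\<close>, which is the first coordinate of \<open>twist\<close>; the second coordinate
  there is the word \<open>q t\<close> itself.\<close>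

lemma Om_commute:
  assumes "m \<in> supported (normal_words (Suc n))" "A \<subseteq> {1..n}"
  shows "Om (side_op False F A m) = side_op True F A (Om m) + nabla (side_op False F) (side_op True F) A m"
proof (rule linear_eq_on_normal_words[OF _ _ assms(1)])
  show "Vector_Spaces.linear scl scl (\<lambda>m. Om (side_op False F A m))"
    using Vector_Spaces.linear_compose[OF pair.X.V_linear scl.ext_linear] by (simp add: o_def)
  show "Vector_Spaces.linear scl scl (\<lambda>m. side_op True F A (Om m) + nabla (side_op False F) (side_op True F) A m)"
    by (rule linear_add[OF _ pair.nabla_linear])
      (use Vector_Spaces.linear_compose[OF scl.ext_linear pair.X'.V_linear] in \<open>simp add: o_def\<close>)
next
  fix q t assume qt: "q \<in> normal_words n" "t \<in> normal_words (Suc n)" "\<not> starts False t"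
  let ?z = "twisted (monomial n q) (0, basis_vec t)"
  have snd: "snd ?z = basis_vec (attach False q t)"
    using pair.snd_act_twist act_side_monomial[OF qt(1,3)] by simp
  have "Om (side_op False F A (basis_vec (attach False q t))) = Om (joins False t (F A q))"
    using side_op_joins[OF qt(3), of A "basis_vec q"] by simp
  also have "\<dots> = joins True (Gen # t) (F A q) + fst (twist (side_op False F) (side_op True F) A ?z)"
    unfolding Om_joins[OF qt(3)] twisted_F[OF qt(1) assms(2) qt(2)] ..
  also have "joins True (Gen # t) (F A q) = side_op True F A (basis_vec (attach True q (Gen # t)))"
    using side_op_joins[of True "Gen # t" A "basis_vec q"] by simp
  also have "fst (twist (side_op False F) (side_op True F) A ?z) =
      side_op True F A (fst ?z) + nabla (side_op False F) (side_op True F) A (snd ?z)"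
    by (simp add: twist_def split: prod.splits)
  finally show "Om (side_op False F A (basis_vec (attach False q t))) =
      side_op True F A (Om (basis_vec (attach False q t))) +
        nabla (side_op False F) (side_op True F) A (basis_vec (attach False q t))"
    by (simp add: snd gen_op_attach[OF qt(3)] pair.X'.V_add)
qed

end

subsection \<open>Passing from \<open>n\<close> to \<open>Suc n\<close>\<close>

definition qcong :: "nat \<Rightarrow> (nat set fword \<Rightarrow>\<^sub>0 'f::field) \<Rightarrow> (nat set fword \<Rightarrow>\<^sub>0 'f) \<Rightarrow> bool" where
  "qcong n p q \<longleftrightarrow> p - q \<in> relation_ideal n"

lemma qcong_refl: "qcong n p p"
  by (simp add: qcong_def relation_ideal.zero)

lemma qcong_trans [trans]: "qcong n p q \<Longrightarrow> qcong n q r \<Longrightarrow> qcong n p r"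
  unfolding qcong_def using relation_ideal.add by fastforce

lemma qcong_add: "qcong n p q \<Longrightarrow> qcong n p' q' \<Longrightarrow> qcong n (p + p') (q + q')"
  unfolding qcong_def using relation_ideal.add by (simp add: add_diff_add)

lemma qcong_diff: "qcong n p q \<Longrightarrow> qcong n p' q' \<Longrightarrow> qcong n (p - p') (q - q')"
  unfolding qcong_def using relation_ideal_diff[of "p - q" n "p' - q'"] by (simp add: algebra_simps)

lemma qcong_mult_left: "qcong n p q \<Longrightarrow> qcong n (a * p) (a * q)"
  unfolding qcong_def using relation_ideal_mult_left[of "p - q" n a] by (simp add: algebra_simps)

lemma qcong_mult_right: "qcong n p q \<Longrightarrow> qcong n (p * a) (q * a)"
  unfolding qcong_def using relation_ideal_mult_right[of "p - q" n a] by (simp add: algebra_simps)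

lemma qcong_linear:
  assumes "Vector_Spaces.linear scl scl g" "Vector_Spaces.linear scl scl h"
    and "\<And>k. k \<in> Poly_Mapping.keys p \<Longrightarrow> qcong n (g (basis_vec k)) (h (basis_vec k))"
  shows "qcong n (g p) (h p)"
proof -
  interpret g: Vector_Spaces.linear scl scl g by fact
  interpret h: Vector_Spaces.linear scl scl h by fact
  have "Vector_Spaces.linear scl scl (\<lambda>p. g p - h p)"
    by unfold_locales (simp_all add: g.add h.add g.scale h.scale scl.scale_right_diff_distrib)
  then have "g p - h p = ext scl (\<lambda>k. g (basis_vec k) - h (basis_vec k)) p"
    by (rule scl.linear_ext)
  also have "\<dots> \<in> relation_ideal n"
    using assms(3) by (intro scl.ext_in_subspace[OF subspace_relation_ideal]) (auto simp: qcong_def)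
  finally show ?thesis by (simp add: qcong_def)
qed

lemma copy_empty [simp]: "copy n b {} = 0"
  by (simp add: copy_def v_def)

lemma subst_copy_v [simp]: "subst (copy n b) (v A) = copy n b A"
  by (cases "A = {}") (simp_all add: v_def)

text \<open>In the primed copy all generators are shifted by the same element
  \<open>v {Suc n}\<close>, and in a relation the terms containing this shift cancel. The image is
  therefore exactly the relation for the enlarged set.\<close>

lemma subst_copy_relation:
  assumes "r \<in> Q_relations n"
  shows "subst (copy n b) r \<in> relation_ideal (Suc n)"
proof -
  obtain A i j where r: "r = Q_relation A i j" and A: "A \<subseteq> {1..n}" "i \<in> A" "j \<in> A" "i \<noteq> j"
    using assms by (auto simp: Q_relations_def)
  let ?A = "if b then insert (Suc n) A else A"
  have ne: "i \<noteq> Suc n" "j \<noteq> Suc n" using A by auto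
  have "insert (Suc n) A - {i} = insert (Suc n) (A - {i})"
    "insert (Suc n) A - {j} = insert (Suc n) (A - {j})"
    "insert (Suc n) A - {i, j} = insert (Suc n) (A - {i, j})" using ne by auto
  then have "subst (copy n b) r = Q_relation ?A i j"
    unfolding r Q_relation_def subst_add subst_diff subst_mult subst_power subst_copy_v
    by (cases b) (simp_all add: copy_def power2_eq_square algebra_simps)
  moreover have "?A \<subseteq> {1..Suc n}" "i \<in> ?A" "j \<in> ?A" using A by auto
  then have "Q_relation ?A i j \<in> Q_relations (Suc n)"
    using A(4) unfolding Q_relations_def by blast
  ultimately show ?thesis using relation_ideal_relation by metis
qed

lemma (in vector_space) ext_add_fun: "ext scale (\<lambda>k. f k + g k) p = ext scale f p + ext scale g p"
  by (simp add: ext_def scale_right_distrib sum.distrib)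

context Q_level
begin

abbreviation "L A \<equiv> ext scl (step_op n F A)"

lemma L_eq:
  "L A m = (if Suc n \<in> A then side_op True F (A - {Suc n}) m + Om m else side_op False F A m)"
proof -
  have "step_op n F A =
      (if Suc n \<in> A then (\<lambda>u. side True F (A - {Suc n}) u + gen_op n F u) else side False F A)"
    by (simp add: fun_eq_iff step_op_def)
  then show ?thesis by (simp add: scl.ext_add_fun side_op_def)
qed

lemma Om_add: "Om (m + m') = Om m + Om m'" and Om_diff: "Om (m - m') = Om m - Om m'"
  by (rule scl.ext_add, rule module_hom.diff[OF Vector_Spaces.linear.axioms(3)[OF scl.ext_linear]])

lemma L_rep: "free_rep scl L"
  by (intro free_rep.intro free_rep_axioms.intro scl.vector_space_axioms scl.ext_linear)

text \<open>If \<open>Suc n\<close> is not in \<open>B\<close>, the relation lives in the unprimed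
  copy. If \<open>Suc n\<close> is one of the two removed indices, it is an instance of the
  commutation rule. If \<open>Suc n\<close> stays in all sets, the operators are the primed ones
  shifted by \<open>Om\<close>, which changes \<open>qsym\<close> only by terms free of the middle
  set.\<close>

lemma L_module: "Q_module scl L (supported (normal_words (Suc n))) (Suc n)"
proof (intro Q_module.intro Q_module_axioms.intro L_rep subspace_supported)
  fix A and m :: "block list \<Rightarrow>\<^sub>0 'f"
  assume m: "m \<in> supported (normal_words (Suc n))"
  then show "L A m \<in> supported (normal_words (Suc n))"
    unfolding L_eq
    by (auto intro!: pair.X.V_closed pair.X'.V_closed Om_closed scl.subspace_add[OF subspace_supported]
        simp del: normal_words.simps)
next
  fix m show "L {} m = 0" by (simp add: L_eq)
next
  fix B :: "nat set" and i j :: nat and m :: "block list \<Rightarrow>\<^sub>0 'f"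
  assume m: "m \<in> supported (normal_words (Suc n))"
    and B: "B \<subseteq> {1..Suc n}" "i \<in> B" "j \<in> B" "i \<noteq> j"
  let ?X = "side_op False F" and ?X' = "side_op True F"
  have mixed: "qsym L B (B - {i}) (B - {i, j}) m = qsym L B (B - {j}) (B - {i, j}) m"
    if B: "B \<subseteq> {1..Suc n}" "i \<in> B" "j \<in> B" "i = Suc n" "j \<noteq> Suc n" for i j
  proof -
    define C where "C = B - {Suc n}"
    define D where "D = C - {j}"
    have C: "C \<subseteq> {1..n}" "D \<subseteq> {1..n}" "j \<in> C" using B by (auto simp: C_def D_def le_Suc_eq)
    have sets: "B - {i} = C" "B - {i, j} = D" "B - {j} - {Suc n} = D"
      using B by (auto simp: C_def D_def)
    have ops: "L B z = ?X' C z + Om z" "L (B - {i}) z = ?X C z" "L (B - {i, j}) z = ?X D z"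
      "L (B - {j}) z = ?X' D z + Om z" for z
      unfolding L_eq using B sets by (auto simp: C_def D_def)
    \<comment> \<open>Subtracting the commutation rules for \<open>C\<close> and for
      \<open>D\<close> leaves the edge value of \<open>nabla\<close> between them, which is the
      relation with indices \<open>Suc n\<close> and \<open>j\<close>.\<close>
    have "Om (?X C m) = ?X' C (Om m) + (nabla ?X ?X' D m + skew_step ?X ?X' m C D)"
      using Om_commute[OF m C(1)] pair.nabla_step[OF m C(1,3)] by (simp add: D_def)
    then show ?thesis
      using Om_commute[OF m C(2)] unfolding qsym_def ops
      by (simp add: skew_step_def pair.additive Om_add Om_diff algebra_simps)
  qed
  consider "Suc n \<notin> B" | "i = Suc n" | "j = Suc n" | "Suc n \<in> B" "i \<noteq> Suc n" "j \<noteq> Suc n" by blast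
  then show "qsym L B (B - {i}) (B - {i, j}) m = qsym L B (B - {j}) (B - {i, j}) m"
  proof cases
    case 1
    then have "B \<subseteq> {1..n}" using B by (auto simp: le_Suc_eq)
    then show ?thesis
      using 1 pair.X.V_sym[OF m _ B(2-)] by (simp add: qsym_def L_eq)
  next
    case 2
    then show ?thesis using mixed[of i j] B by auto
  next
    case 3
    then show ?thesis using mixed[of j i] B by (auto simp: insert_commute)
  next
    case 4
    define C where "C = B - {Suc n}"
    have C: "C \<subseteq> {1..n}" "i \<in> C" "j \<in> C" using B 4 by (auto simp: C_def le_Suc_eq)
    have sets: "B - {i} - {Suc n} = C - {i}" "B - {j} - {Suc n} = C - {j}"
      "B - {i, j} - {Suc n} = C - {i, j}" by (auto simp: C_def)
    have ops: "L B z = ?X' C z + Om z" "L (B - {i}) z = ?X' (C - {i}) z + Om z"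
      "L (B - {j}) z = ?X' (C - {j}) z + Om z" "L (B - {i, j}) z = ?X' (C - {i, j}) z + Om z" for z
      unfolding L_eq sets using 4 B by (auto simp: C_def)
    show ?thesis
      using pair.X'.V_sym[OF m C B(4)] unfolding qsym_def ops
      by (simp add: pair.additive Om_add Om_diff algebra_simps)
  qed
qed

sublocale step: Q_module scl L "supported (normal_words (Suc n))" "Suc n"
  by (rule L_module)

lemma act_copy:
  assumes "A \<in> Q_basis n"
  shows "act scl L (copy n b A) m = side_op b F A m"
proof -
  have "Suc n \<notin> A" using assms by (auto simp: Q_basis_def)
  then show ?thesis
    by (auto simp: copy_def step.act_diff L_eq)
qed

lemma act_step_monomial:
  assumes "c \<in> normal_words n"
  shows "act scl L (subst (copy n b) (monomial n c)) m = act scl (side_op b F) (monomial n c) m"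
  by (intro step.act_subst act_copy monomial_letters[OF assms])

text \<open>Acting from right to left, each new block is simply put in front: admissibility excludes
  every situation in which the operators would have to rewrite.\<close>

lemma step_act_monomial:
  assumes "u \<in> normal_words (Suc n)"
  shows "act scl L (monomial (Suc n) u) (basis_vec []) = basis_vec u"
proof -
  from assms have "admissible (normal_words n) u" by simp
  then show ?thesis
  proof (induct "normal_words n" u rule: admissible.induct)
    case (2 t)
    \<comment> \<open>The primed part belongs to the empty set and vanishes. Since \<open>t\<close>
      does not start in the first copy, its split-off factor is empty, and \<open>nabla\<close> of
      \<open>1\<close> contributes nothing.\<close>
    then have "step_op n F {Suc n} t = basis_vec (Gen # t)"
      using gen_op_attach[of t "[]"]
      by (simp add: step_op_def side_def F_empty module_hom.zero[OF joins_hom] split: prod.splits)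
    then show ?case using 2 by (simp add: step.act_mult)
  next
    case (3 b c t)
    then show ?case
      by (simp add: step.act_mult act_step_monomial act_side_monomial attach_def)
  qed simp
qed

section \<open>The operators as left multiplication modulo the relations\<close>

abbreviation "M \<equiv> ext scl (monomial (Suc n))"

lemma M_add: "M (p + q) = M p + M q" and M_diff: "M (p - q) = M p - M q"
  by (rule scl.ext_add, rule module_hom.diff[OF Vector_Spaces.linear.axioms(3)[OF scl.ext_linear]])

lemma M_joins: "M (joins b t p) = subst (copy n b) (ext scl (monomial n) p) * monomial (Suc n) t"
proof (rule scl.linear_eq_on_basis[where g = "\<lambda>p. M (joins b t p)"])
  show "Vector_Spaces.linear scl scl (\<lambda>p. M (joins b t p))"
    using Vector_Spaces.linear_compose[OF joins_linear scl.ext_linear] by (simp add: o_def)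
  show "Vector_Spaces.linear scl scl (\<lambda>p. subst (copy n b) (ext scl (monomial n) p) * monomial (Suc n) t)"
    using Vector_Spaces.linear_compose[OF Vector_Spaces.linear_compose[OF scl.ext_linear subst_linear]
        mult_linear(2)] by (simp only: o_def)
qed (simp add: monomial_attach del: monomial.simps)

lemma M_side:
  assumes "m \<in> supported (normal_words (Suc n))" "A \<subseteq> {1..n}"
  shows "qcong (Suc n) (M (side_op b F A m)) (copy n b A * M m)"
proof (rule qcong_linear[where g = "\<lambda>m. M (side_op b F A m)" and h = "\<lambda>m. copy n b A * M m"])
  show "Vector_Spaces.linear scl scl (\<lambda>m. M (side_op b F A m))"
    unfolding side_op_def using Vector_Spaces.linear_compose[OF scl.ext_linear scl.ext_linear]
    by (simp add: o_def)
  show "Vector_Spaces.linear scl scl (\<lambda>m. copy n b A * M m)"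
    using Vector_Spaces.linear_compose[OF scl.ext_linear mult_linear(1)] by (simp only: o_def)
next
  fix u assume "u \<in> Poly_Mapping.keys m"
  then have "u \<in> normal_words (Suc n)" using assms by (auto simp: supported_def)
  then obtain c t where u: "u = attach b c t" "c \<in> normal_words n" "\<not> starts b t"
    by (rule normal_words_attach_cases)
  have "subst (copy n b) (ext scl (monomial n) (F A c) - v A * monomial n c) \<in> relation_ideal (Suc n)"
    by (rule subst_relation_ideal[OF subst_copy_relation monomial_cong[OF u(2) assms(2)]])
  then have "qcong (Suc n) (subst (copy n b) (ext scl (monomial n) (F A c)))
      (copy n b A * subst (copy n b) (monomial n c))"
    by (simp add: qcong_def subst_diff subst_mult)
  from qcong_mult_right[OF this]
  show "qcong (Suc n) (M (side_op b F A (basis_vec u))) (copy n b A * M (basis_vec u))"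
    by (simp add: u side_op_def side_attach M_joins monomial_attach mult.assoc del: monomial.simps)
qed

text \<open>Here the mixed relations of \<open>Q_algebra (Suc n)\<close> enter: along the path that
  defines \<open>nabla\<close>, each edge is accounted for by one relation with the indices
  \<open>Max B\<close> and \<open>Suc n\<close>.\<close>

lemma M_nabla:
  assumes "m \<in> supported (normal_words (Suc n))" "B \<subseteq> {1..n}"
  shows "qcong (Suc n) (M (nabla (side_op False F) (side_op True F) B m))
    ((v {Suc n} * copy n False B - copy n True B * v {Suc n}) * M m)"
proof -
  let ?X = "side_op False F" and ?X' = "side_op True F" and ?w = "v {Suc n} :: nat set fword \<Rightarrow>\<^sub>0 'f"
  let ?x = "copy n False :: nat set \<Rightarrow> nat set fword \<Rightarrow>\<^sub>0 'f"
    and ?x' = "copy n True :: nat set \<Rightarrow> nat set fword \<Rightarrow>\<^sub>0 'f"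
  have "finite B" using assms(2) finite_subset by blast
  then show ?thesis
    using assms(2)
  proof (induct B rule: pot_induct)
    case empty
    then show ?case by (simp add: nabla_def qcong_refl)
  next
    case (step B)
    define C where "C = B - {Max B}"
    have B: "Max B \<in> B" "C \<subseteq> {1..n}" using step by (auto simp: C_def)
    note side = M_side[OF _ step(4)] M_side[OF _ B(2)]
    note closed = assms(1) pair.X.V_closed[OF assms(1)] pair.X'.V_closed[OF assms(1)]
      scl.subspace_diff[OF subspace_supported]
    have comp: "qcong (Suc n) (M (side_op b F D z)) (copy n b D * q)"
      if "D \<in> {B, C}" "z \<in> supported (normal_words (Suc n))" "qcong (Suc n) (M z) q" for b D z q
      using that side qcong_trans[OF _ qcong_mult_left[OF that(3)]] by auto
    have M_qdiff: "qcong (Suc n) (M (z - z')) (q - q')"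
      if "qcong (Suc n) (M z) q" "qcong (Suc n) (M z') q'" for z z' q q'
      unfolding M_diff by (rule qcong_diff[OF that])
    have "qcong (Suc n) (M (skew_step ?X ?X' m B C))
        (?x' B * (?x' C * M m - ?x C * M m) - ?x' C * (?x' C * M m - ?x C * M m) -
          (?x' B * (?x B * M m - ?x C * M m) - ?x B * (?x B * M m - ?x C * M m)))"
      unfolding skew_step_def by (intro M_qdiff comp closed qcong_refl) simp_all
    moreover have "Q_relation (insert (Suc n) B) (Max B) (Suc n) \<in> Q_relations (Suc n)"
    proof -
      have "insert (Suc n) B \<subseteq> {1..Suc n}" "Max B \<noteq> Suc n" using step(4) B by auto
      then show ?thesis using B unfolding Q_relations_def by blast
    qed
    \<comment> \<open>A summand congruent to zero: once it is added, passing from \<open>C\<close>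
      to \<open>B\<close> becomes an identity in the free algebra.\<close>
    then have "qcong (Suc n) 0 (- Q_relation (insert (Suc n) B) (Max B) (Suc n) * M m)"
      unfolding qcong_def mult_minus_left diff_0 minus_minus
      by (intro relation_ideal_mult_right relation_ideal_relation)
    ultimately have "qcong (Suc n)
        (M (nabla ?X ?X' C m) + M (skew_step ?X ?X' m B C) + 0)
        ((?w * ?x C - ?x' C * ?w) * M m +
          (?x' B * (?x' C * M m - ?x C * M m) - ?x' C * (?x' C * M m - ?x C * M m) -
          (?x' B * (?x B * M m - ?x C * M m) - ?x B * (?x B * M m - ?x C * M m))) +
          - Q_relation (insert (Suc n) B) (Max B) (Suc n) * M m)"
      using step(3) B(2) unfolding C_def by (intro qcong_add)
    moreover have "Suc n \<notin> B" "Max B \<noteq> Suc n" using step(4) B by auto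
    then have "insert (Suc n) B - {Max B} = insert (Suc n) C" "insert (Suc n) B - {Suc n} = B"
      "insert (Suc n) B - {Max B, Suc n} = C" by (auto simp: C_def)
    then have "(?w * ?x C - ?x' C * ?w) * M m +
          (?x' B * (?x' C * M m - ?x C * M m) - ?x' C * (?x' C * M m - ?x C * M m) -
          (?x' B * (?x B * M m - ?x C * M m) - ?x B * (?x B * M m - ?x C * M m))) +
          - Q_relation (insert (Suc n) B) (Max B) (Suc n) * M m =
        (?w * ?x B - ?x' B * ?w) * M m"
      by (simp add: Q_relation_def copy_def power2_eq_square algebra_simps)
    moreover have "nabla ?X ?X' B m = nabla ?X ?X' C m + skew_step ?X ?X' m B C"
      unfolding C_def by (rule pair.nabla_step[OF assms(1) step(4) B(1)])
    ultimately show ?case by (simp add: M_add del: monomial.simps)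
  qed
qed

text \<open>The map sending \<open>p\<close> to \<open>w * p - p' * w\<close> is itself a skew
  derivation and agrees with \<open>nabla\<close> on letters by \<open>M_nabla\<close>, so the two
  agree on all words. The induction over a word also carries the second coordinate, since
  \<open>nabla\<close> of the next letter is applied to it.\<close>

lemma M_twisted:
  assumes "t \<in> normal_words (Suc n)" "\<not> starts False t"
    and "\<And>w A. w \<in> Poly_Mapping.keys p \<Longrightarrow> A \<in> set (letters w) \<Longrightarrow> A \<in> Q_basis n"
  shows "qcong (Suc n) (M (fst (twisted p (0, basis_vec t))))
    ((v {Suc n} * subst (copy n False) p - subst (copy n True) p * v {Suc n}) * monomial (Suc n) t)"
proof (rule qcong_linear[where p = p])
  show "Vector_Spaces.linear scl scl (\<lambda>p. M (fst (twisted p (0, basis_vec t))))"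
  proof -
    have "Vector_Spaces.linear (scale2 scl) scl (fst :: _ \<Rightarrow> block list \<Rightarrow>\<^sub>0 'f)"
      by (intro Vector_Spaces.linear.intro module_hom.intro module_hom_axioms.intro
          scl.vector_space_axioms scl.module_axioms tw.vector_space_axioms tw.module_axioms)
        (auto simp: scale2_def)
    from Vector_Spaces.linear_compose[OF Vector_Spaces.linear_compose[OF tw.act_linear this] scl.ext_linear]
    show ?thesis by (simp only: o_def)
  qed
  show "Vector_Spaces.linear scl scl (\<lambda>p.
      (v {Suc n} * subst (copy n False) p - subst (copy n True) p * v {Suc n}) * monomial (Suc n) t)"
    by (intro Vector_Spaces.linear.intro module_hom.intro module_hom_axioms.intro
        scl.vector_space_axioms scl.module_axioms)
      (simp_all add: subst_add module_hom.scale[OF Vector_Spaces.linear.axioms(3)[OF subst_linear]]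
        scl_mult_left scl_mult_right algebra_simps scl.scale_right_diff_distrib del: monomial.simps)
next
  fix k assume k: "k \<in> Poly_Mapping.keys p"
  let ?tw = "twist (side_op False F) (side_op True F)" and ?w = "v {Suc n} :: nat set fword \<Rightarrow>\<^sub>0 'f"
  let ?x = "copy n False :: nat set \<Rightarrow> nat set fword \<Rightarrow>\<^sub>0 'f"
    and ?x' = "copy n True :: nat set \<Rightarrow> nat set fword \<Rightarrow>\<^sub>0 'f"
  let ?m = "monomial (Suc n) t"
  have "foldr ?tw xs (0, basis_vec t) \<in> supported (normal_words (Suc n)) \<times> supported (normal_words (Suc n)) \<and>
      qcong (Suc n) (M (snd (foldr ?tw xs (0, basis_vec t)))) (subst ?x (basis_vec (Word xs)) * ?m) \<and>
      qcong (Suc n) (M (fst (foldr ?tw xs (0, basis_vec t))))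
        ((?w * subst ?x (basis_vec (Word xs)) - subst ?x' (basis_vec (Word xs)) * ?w) * ?m)"
    if "set xs \<subseteq> Q_basis n" for xs
    using that
  proof (induct xs)
    case Nil
    have "subst g (basis_vec (Word [])) = 1" for g :: "nat set \<Rightarrow> nat set fword \<Rightarrow>\<^sub>0 'f"
      by (simp add: subst_def)
    then show ?case
      using assms(1) scl.subspace_0[OF subspace_supported]
      by (simp add: qcong_refl del: normal_words.simps monomial.simps)
  next
    case (Cons A xs)
    obtain x y where xy: "foldr ?tw xs (0, basis_vec t) = (x, y)" by fastforce
    let ?q = "subst ?x (basis_vec (Word xs))" and ?q' = "subst ?x' (basis_vec (Word xs))"
    have A: "A \<subseteq> {1..n}" using Cons.prems by (auto simp: Q_basis_def)
    have IH: "x \<in> supported (normal_words (Suc n))" "y \<in> supported (normal_words (Suc n))"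
      "qcong (Suc n) (M y) (?q * ?m)" "qcong (Suc n) (M x) ((?w * ?q - ?q' * ?w) * ?m)"
      using Cons xy by (auto simp del: monomial.simps normal_words.simps)
    have step: "subst g (basis_vec (Word (A # xs))) = g A * subst g (basis_vec (Word xs))"
      for g :: "nat set \<Rightarrow> nat set fword \<Rightarrow>\<^sub>0 'f"
      by (simp add: subst_def)
    have tw: "foldr ?tw (A # xs) (0, basis_vec t) =
        (side_op True F A x + nabla (side_op False F) (side_op True F) A y, side_op False F A y)"
      by (simp add: xy) (simp add: twist_def)
    have closed: "foldr ?tw (A # xs) (0, basis_vec t) \<in>
        supported (normal_words (Suc n)) \<times> supported (normal_words (Suc n))"
      using tw.V_closed[of "(x, y)" A] IH(1,2) xy by simp
    have 1: "qcong (Suc n) (M (side_op False F A y)) (?x A * (?q * ?m))"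
      by (rule qcong_trans[OF M_side[OF IH(2) A] qcong_mult_left[OF IH(3)]])
    have "qcong (Suc n) (M (side_op True F A x) + M (nabla (side_op False F) (side_op True F) A y))
        (?x' A * ((?w * ?q - ?q' * ?w) * ?m) + (?w * ?x A - ?x' A * ?w) * (?q * ?m))"
      by (intro qcong_add qcong_trans[OF M_side[OF IH(1) A] qcong_mult_left[OF IH(4)]]
          qcong_trans[OF M_nabla[OF IH(2) A] qcong_mult_left[OF IH(3)]])
    also have "?x' A * ((?w * ?q - ?q' * ?w) * ?m) + (?w * ?x A - ?x' A * ?w) * (?q * ?m) =
        (?w * (?x A * ?q) - (?x' A * ?q') * ?w) * ?m"
      by (simp add: algebra_simps del: monomial.simps)
    finally show ?case
      using closed 1 unfolding tw step by (simp add: M_add mult.assoc del: monomial.simps)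
  qed
  from this[of "letters k"] show "qcong (Suc n) (M (fst (twisted (basis_vec k) (0, basis_vec t))))
      ((?w * subst ?x (basis_vec k) - subst ?x' (basis_vec k) * ?w) * ?m)"
    using assms(3)[OF k] by (cases k) (auto simp: act_def scale2_def split: prod.splits simp del: monomial.simps)
qed

text \<open>The leading word of \<open>gen_op\<close> realizes \<open>q' * w * t\<close>, and the
  correction realizes \<open>(w * q - q' * w) * t\<close>; their sum telescopes.\<close>

lemma M_Om:
  assumes "u \<in> normal_words (Suc n)"
  shows "qcong (Suc n) (M (gen_op n F u)) (v {Suc n} * monomial (Suc n) u)"
proof -
  obtain q t where u: "u = attach False q t" "q \<in> normal_words n" "t \<in> normal_words (Suc n)" "\<not> starts False t"
    using assms by (rule normal_words_attach_cases)
  let ?q = "\<lambda>b. subst (copy n b) (monomial n q) :: nat set fword \<Rightarrow>\<^sub>0 'f"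
  have "qcong (Suc n) (M (gen_op n F u)) (?q True * (v {Suc n} * monomial (Suc n) t) +
      (v {Suc n} * ?q False - ?q True * v {Suc n}) * monomial (Suc n) t)"
    unfolding u(1) gen_op_attach[OF u(4)] M_add
    by (intro qcong_add M_twisted[OF u(3,4) monomial_letters[OF u(2)]])
      (simp_all add: monomial_attach monomial_Gen qcong_refl del: monomial.simps)
  then show ?thesis
    by (simp add: u(1) monomial_attach algebra_simps del: monomial.simps)
qed

lemma step_monomial_cong:
  assumes "u \<in> normal_words (Suc n)" "A \<subseteq> {1..Suc n}"
  shows "qcong (Suc n) (M (step_op n F A u)) (v A * monomial (Suc n) u)"
proof -
  have side: "qcong (Suc n) (M (side b F B u)) (copy n b B * monomial (Suc n) u)" if "B \<subseteq> {1..n}" for b B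
    using M_side[of "basis_vec u" B b] assms(1) that by (simp add: side_op_def del: monomial.simps)
  show ?thesis
  proof (cases "Suc n \<in> A")
    case True
    let ?B = "A - {Suc n}"
    have "qcong (Suc n) (M (step_op n F A u)) (copy n True ?B * monomial (Suc n) u + v {Suc n} * monomial (Suc n) u)"
      using True assms unfolding step_op_def
      by (auto simp: M_add le_Suc_eq intro!: qcong_add side M_Om simp del: monomial.simps normal_words.simps)
    then show ?thesis
      using True by (simp add: copy_def insert_absorb algebra_simps del: monomial.simps)
  next
    case False
    then have "A \<subseteq> {1..n}" using assms(2) by (auto simp: le_Suc_eq)
    from side[OF this, of False] show ?thesis
      using False by (simp add: step_op_def copy_def cong: if_cong del: monomial.simps)
  qed
qed

lemma Q_level_Suc: "Q_level (Suc n) (step_op n F)"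
  by (intro Q_level.intro L_module Q_level_axioms.intro step_act_monomial
      step_monomial_cong[unfolded qcong_def])

end

lemma Q_level_left_mult: "Q_level n (left_mult n)"
proof (induct n)
  case 0
  interpret R: free_rep scl "\<lambda>A. ext scl (left_mult 0 A :: block list \<Rightarrow> block list \<Rightarrow>\<^sub>0 'a)"
    by (intro free_rep.intro free_rep_axioms.intro scl.vector_space_axioms scl.ext_linear)
  have "act scl (\<lambda>A. ext scl (left_mult 0 A)) (monomial 0 u) (basis_vec []) = (basis_vec [] :: _ \<Rightarrow>\<^sub>0 'a)" for u
    by (simp only: monomial.simps R.act_one)
  \<comment> \<open>At level zero a relation would need two indices in an empty set, and the only
    letter to be checked is \<open>v {} = 0\<close>.\<close>
  then show ?case
    by unfold_locales (auto simp: subspace_supported scl.ext_add scl.ext_scl ext_def qsym_def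
      scl.subspace_0[OF subspace_supported] v_def relation_ideal.zero)
next
  case (Suc n)
  then show ?case using Q_level.Q_level_Suc by simp
qed

section \<open>Counting normal words\<close>

definition gen_fun :: "'a set \<Rightarrow> ('a \<Rightarrow> nat) \<Rightarrow> rat fps" where
  "gen_fun A d = Abs_fps (\<lambda>i. of_nat (card {x \<in> A. d x = i}))"

definition graded_finite :: "'a set \<Rightarrow> ('a \<Rightarrow> nat) \<Rightarrow> bool" where
  "graded_finite A d \<longleftrightarrow> (\<forall>i. finite {x \<in> A. d x = i})"

lemma graded_finite_subset: "graded_finite B d \<Longrightarrow> A \<subseteq> B \<Longrightarrow> graded_finite A d"
proof -
  assume B: "graded_finite B d" and A: "A \<subseteq> B"
  have "{x \<in> A. d x = i} \<subseteq> {x \<in> B. d x = i}" for i using A by auto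
  then show ?thesis using B unfolding graded_finite_def by (intro allI) (rule finite_subset, assumption, rule spec)
qed

lemma gen_fun_Un:
  assumes "graded_finite A d" "graded_finite B d" "A \<inter> B = {}"
  shows "gen_fun (A \<union> B) d = gen_fun A d + gen_fun B d"
proof (rule fps_ext)
  fix i
  have "{x \<in> A \<union> B. d x = i} = {x \<in> A. d x = i} \<union> {x \<in> B. d x = i}" by auto
  moreover have "card \<dots> = card {x \<in> A. d x = i} + card {x \<in> B. d x = i}"
    using assms by (intro card_Un_disjoint) (auto simp: graded_finite_def)
  ultimately show "fps_nth (gen_fun (A \<union> B) d) i = fps_nth (gen_fun A d + gen_fun B d) i"
    by (simp add: gen_fun_def)
qed

lemma gen_fun_Diff:
  assumes "graded_finite A d" "B \<subseteq> A"
  shows "gen_fun (A - B) d = gen_fun A d - gen_fun B d"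
proof -
  have "gen_fun ((A - B) \<union> B) d = gen_fun (A - B) d + gen_fun B d"
    by (rule gen_fun_Un) (use assms graded_finite_subset in \<open>blast+\<close>)
  moreover have "(A - B) \<union> B = A" using assms(2) by auto
  ultimately show ?thesis by simp
qed

lemma gen_fun_bij:
  assumes "bij_betw f A B" "\<And>x. x \<in> A \<Longrightarrow> e (f x) = d x"
  shows "gen_fun B e = gen_fun A d"
proof (rule fps_ext)
  fix i
  have "bij_betw f {x \<in> A. d x = i} {y \<in> B. e y = i}"
    using assms by (auto simp: bij_betw_def inj_on_def)
  then show "fps_nth (gen_fun B e) i = fps_nth (gen_fun A d) i"
    by (simp add: gen_fun_def bij_betw_same_card)
qed

lemma gen_fun_Times:
  assumes "graded_finite A d" "graded_finite B e"
  shows "gen_fun (A \<times> B) (\<lambda>(x, y). d x + e y) = gen_fun A d * gen_fun B e"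
proof (rule fps_ext)
  fix i
  let ?P = "\<lambda>j. {x \<in> A. d x = j} \<times> {y \<in> B. e y = i - j}"
  have "{p \<in> A \<times> B. (\<lambda>(x, y). d x + e y) p = i} = (\<Union>j\<in>{0..i}. ?P j)" by auto
  moreover have "card (\<Union>j\<in>{0..i}. ?P j) = (\<Sum>j=0..i. card (?P j))"
    using assms by (intro card_UN_disjoint) (auto simp: graded_finite_def)
  ultimately show "fps_nth (gen_fun (A \<times> B) (\<lambda>(x, y). d x + e y)) i = fps_nth (gen_fun A d * gen_fun B e) i"
    by (simp add: gen_fun_def fps_mult_nth card_cartesian_product)
qed

lemma gen_fun_shift: "gen_fun A (\<lambda>x. Suc (d x)) = fps_X * gen_fun A d"
proof (rule fps_ext)
  fix i show "fps_nth (gen_fun A (\<lambda>x. Suc (d x))) i = fps_nth (fps_X * gen_fun A d) i"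
    by (cases i) (simp_all add: gen_fun_def)
qed

lemma gen_fun_degree_0:
  assumes "d x = 0" shows "gen_fun {x} d = 1"
proof (rule fps_ext)
  fix i
  have "{y \<in> {x}. d y = i} = (if i = 0 then {x} else {})" using assms by auto
  then show "fps_nth (gen_fun {x} d) i = fps_nth 1 i" by (simp add: gen_fun_def)
qed

lemma word_degree_simps [simp]:
  "word_degree [] = 0" "word_degree (Gen # t) = Suc (word_degree t)"
  "word_degree (Block b c # t) = word_degree c + word_degree t"
  by (simp_all add: word_degree_def)

lemma word_degree_pos:
  "u \<in> normal_words n \<Longrightarrow> u \<noteq> [] \<Longrightarrow> 0 < word_degree u"
proof (induct n arbitrary: u)
  case (Suc n)
  then show ?case by (cases "(normal_words n, u)" rule: admissible.cases) auto
qed simp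

lemma starts_unique: "starts b u \<Longrightarrow> starts b' u \<Longrightarrow> b = b'"
  by (cases "(b, u)" rule: starts.cases) auto

text \<open>The first block of a nonempty normal word has positive degree, so removing it lowers the
  degree by at least one. As the drop varies, the induction is on a bound for the degree rather than
  on its exact value.\<close>

lemma graded_finite_normal_words: "graded_finite (normal_words n) word_degree"
proof (induct n)
  case 0
  then show ?case by (simp add: graded_finite_def)
next
  case (Suc n)
  have "finite {u \<in> normal_words (Suc n). word_degree u \<le> i}" (is "finite (?N i)") for i
  proof (induct i)
    case 0
    have "?N 0 \<subseteq> {[]}" using word_degree_pos by fastforce
    then show ?case by (rule finite_subset) simp
  next
    case (Suc i)
    let ?C = "\<Union>j\<le>Suc i. {c \<in> normal_words n. word_degree c = j}"
    have "?N (Suc i) \<subseteq> insert [] ((#) Gen ` ?N i \<union> (\<lambda>(b, c, t). Block b c # t) ` (UNIV \<times> ?C \<times> ?N i))"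
    proof
      fix u assume u: "u \<in> ?N (Suc i)"
      show "u \<in> insert [] ((#) Gen ` ?N i \<union> (\<lambda>(b, c, t). Block b c # t) ` (UNIV \<times> ?C \<times> ?N i))"
      proof (cases "(normal_words n, u)" rule: admissible.cases)
        case (3 C b c t)
        then have "0 < word_degree c" using u by (auto intro: word_degree_pos)
        then have "(b, c, t) \<in> UNIV \<times> ?C \<times> ?N i" using 3 u by auto
        moreover have "u = (\<lambda>(b, c, t). Block b c # t) (b, c, t)" using 3 by simp
        ultimately show ?thesis by (intro insertI2 UnI2) (rule image_eqI)
      qed (use u in auto)
    qed
    moreover have "finite ?C" using \<open>graded_finite (normal_words n) word_degree\<close>
      by (simp add: graded_finite_def)
    then have "finite (insert [] ((#) Gen ` ?N i \<union> (\<lambda>(b, c, t). Block b c # t) ` (UNIV \<times> ?C \<times> ?N i)))"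
      using Suc by (intro finite.insertI finite_UnI finite_imageI finite_cartesian_product finite_UNIV)
    ultimately show ?case by (rule finite_subset)
  qed
  then show ?case
    unfolding graded_finite_def by (intro allI finite_subset[OF _ \<open>finite (?N _)\<close>]) auto
qed

text \<open>The form without division of \<open>1 / X = (2 - t) / H - 1\<close>. Words are sorted by
  their head: none, a block of either copy, or \<open>Gen\<close>. A word starting in the copy
  \<open>b\<close> is a nonempty factor followed by a word not starting in \<open>b\<close>, which
  gives a linear equation for the series of \<open>?S b\<close>.\<close>

lemma gen_fun_normal_words_Suc:
  fixes n :: nat
  defines "H \<equiv> gen_fun (normal_words n) word_degree"
    and "X \<equiv> gen_fun (normal_words (Suc n)) word_degree"
  shows "X * (2 - fps_X - H) = H"
proof -
  let ?N = "normal_words (Suc n)" and ?C = "normal_words n - {[]}"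
  let ?S = "\<lambda>b. {u \<in> ?N. starts b u}" and ?G = "(#) Gen ` (?N - {u \<in> ?N. starts False u})"
  note fin = graded_finite_subset[OF graded_finite_normal_words, of _ "Suc n"]
  have C: "gen_fun ?C word_degree = H - 1"
    using gen_fun_Diff[OF graded_finite_normal_words, of "{[]}" n] gen_fun_degree_0[of word_degree "[]"]
    by (simp add: H_def)
  have S: "gen_fun (?S b) word_degree = (H - 1) * (X - gen_fun (?S b) word_degree)" for b
  proof -
    have "bij_betw (\<lambda>(c, t). Block b c # t) (?C \<times> (?N - ?S b)) (?S b)"
      unfolding bij_betw_def
    proof (intro conjI equalityI subsetI)
      fix u assume "u \<in> ?S b"
      then obtain c t where "u = Block b c # t" "c \<in> ?C" "t \<in> ?N - ?S b"
        by (cases "(b, u)" rule: starts.cases) auto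
      then show "u \<in> (\<lambda>(c, t). Block b c # t) ` (?C \<times> (?N - ?S b))" by force
    qed (auto simp: inj_on_def)
    then have "gen_fun (?S b) word_degree =
        gen_fun (?C \<times> (?N - ?S b)) (\<lambda>(c, t). word_degree c + word_degree t)"
      by (rule gen_fun_bij) auto
    also have "\<dots> = gen_fun ?C word_degree * gen_fun (?N - ?S b) word_degree"
      by (intro gen_fun_Times fin graded_finite_subset[OF graded_finite_normal_words, of _ n]) auto
    also have "gen_fun (?N - ?S b) word_degree = X - gen_fun (?S b) word_degree"
      unfolding X_def by (intro gen_fun_Diff graded_finite_normal_words) auto
    finally show ?thesis unfolding C .
  qed
  have "bij_betw ((#) Gen) (?N - ?S False) ?G"
    by (auto simp: bij_betw_def)
  then have "gen_fun ?G word_degree = gen_fun (?N - ?S False) (\<lambda>t. Suc (word_degree t))"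
    by (rule gen_fun_bij) simp
  also have "\<dots> = fps_X * (X - gen_fun (?S False) word_degree)"
    unfolding X_def gen_fun_shift
    by (subst gen_fun_Diff[OF graded_finite_normal_words]) auto
  finally have G: "gen_fun ?G word_degree = fps_X * (X - gen_fun (?S False) word_degree)" .
  have N: "?N = {[]} \<union> (?S False \<union> (?S True \<union> ?G))"
  proof (intro equalityI subsetI)
    fix u assume "u \<in> ?N"
    then show "u \<in> {[]} \<union> (?S False \<union> (?S True \<union> ?G))"
      by (cases "(normal_words n, u)" rule: admissible.cases) auto
  qed auto
  have sub: "?G \<subseteq> ?N" by auto
  have "gen_fun ({[]} \<union> (?S False \<union> (?S True \<union> ?G))) word_degree =
      gen_fun {[]} word_degree + gen_fun (?S False \<union> (?S True \<union> ?G)) word_degree"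
    using sub by (intro gen_fun_Un fin) auto
  also have "gen_fun (?S False \<union> (?S True \<union> ?G)) word_degree =
      gen_fun (?S False) word_degree + gen_fun (?S True \<union> ?G) word_degree"
    using sub by (intro gen_fun_Un fin) (auto dest: starts_unique)
  also have "gen_fun (?S True \<union> ?G) word_degree = gen_fun (?S True) word_degree + gen_fun ?G word_degree"
    using sub by (intro gen_fun_Un fin) auto
  finally have "X = gen_fun {[]} word_degree + (gen_fun (?S False) word_degree +
      (gen_fun (?S True) word_degree + gen_fun ?G word_degree))"
    unfolding X_def N[symmetric] .
  \<comment> \<open>The equation for \<open>?S b\<close> determines only \<open>H\<close> times its
    series, namely as \<open>(H - 1) * X\<close>. Multiplying by \<open>H\<close> eliminates both of
    these series at once.\<close>
  from arg_cong[OF this, of "(*) H"]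
  have "H * X = H + H * gen_fun (?S False) word_degree + H * gen_fun (?S True) word_degree +
      fps_X * (H * X - H * gen_fun (?S False) word_degree)"
    unfolding G gen_fun_degree_0[of word_degree, OF word_degree_simps(1)] by (simp add: algebra_simps)
  moreover have "H * gen_fun (?S b) word_degree = (H - 1) * X" for b
    using S[of b] by (simp add: algebra_simps)
  ultimately have "H * X = H + (H - 1) * X + (H - 1) * X + fps_X * (H * X - (H - 1) * X)"
    by (simp only:)
  then show ?thesis by (simp add: algebra_simps)
qed

lemma gen_fun_normal_words:
  "gen_fun (normal_words n) word_degree * (1 - fps_X * (2 - fps_X) ^ n) = 1 - fps_X"
proof (induct n)
  case 0
  have "gen_fun (normal_words 0) word_degree = 1"
    using gen_fun_degree_0[of word_degree "[]"] by simp
  then show ?case by simp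
next
  case (Suc n)
  define H where "H = gen_fun (normal_words n) word_degree"
  define X where "X = gen_fun (normal_words (Suc n)) word_degree"
  define D :: "rat fps" where "D = 1 - fps_X * (2 - fps_X) ^ n"
  have IH: "H * D = 1 - fps_X" using Suc by (simp add: H_def D_def)
  have "X * (2 - fps_X - H) = H"
    unfolding X_def H_def by (rule gen_fun_normal_words_Suc)
  then have "X * ((2 - fps_X) * D - H * D) = H * D"
    by (metis mult.assoc left_diff_distrib)
  then have "X * ((2 - fps_X) * D - (1 - fps_X)) = 1 - fps_X"
    unfolding IH .
  moreover have "(2 - fps_X) * D - (1 - fps_X) = 1 - fps_X * (2 - fps_X) ^ Suc n"
    by (simp add: D_def algebra_simps)
  ultimately show ?case by (simp add: X_def)
qed

section \<open>The Hilbert series\<close>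

lemma subspace_tensor_algebra:
  "scl.subspace (carrier (tensor_algebra X) :: ('x fword \<Rightarrow>\<^sub>0 'f::field) set)"
proof (rule scl.subspaceI)
  fix p q :: "'x fword \<Rightarrow>\<^sub>0 'f"
  show "p + q \<in> carrier (tensor_algebra X)"
    if "p \<in> carrier (tensor_algebra X)" "q \<in> carrier (tensor_algebra X)"
    using that keys_add[of p q] by (fastforce simp: tensor_algebra_def)
  show "scl c p \<in> carrier (tensor_algebra X)" if "p \<in> carrier (tensor_algebra X)" for c
    using that keys_scl[of c p] by (fastforce simp: tensor_algebra_def)
qed (simp add: tensor_algebra_def)

lemma tensor_power_subset: "tensor_power X i \<subseteq> carrier (tensor_algebra X)"
  by (auto simp: tensor_power_def)

lemma tensor_algebra_mult:
  "p \<in> carrier (tensor_algebra X) \<Longrightarrow> q \<in> carrier (tensor_algebra X) \<Longrightarrow> p * q \<in> carrier (tensor_algebra X)"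
  using Ring.ring.ring_simprules(5)[OF tensor_algebra_is_ring, of p X q] by (simp add: tensor_algebra_def)

lemma subst_tensor_algebra:
  fixes p :: "'y fword \<Rightarrow>\<^sub>0 'f::field"
  assumes "\<And>x. g x \<in> carrier (tensor_algebra X)"
  shows "subst g p \<in> carrier (tensor_algebra X)"
  unfolding subst_def act_def
proof (rule scl.ext_in_subspace[OF subspace_tensor_algebra])
  fix k :: "'y fword"
  have "foldr (\<lambda>x. (*) (g x)) xs 1 \<in> carrier (tensor_algebra X)" for xs
    by (induct xs) (simp_all add: tensor_algebra_mult assms, simp add: tensor_algebra_def zero_fword_def)
  then show "foldr (\<lambda>x. (*) (g x)) (letters k) 1 \<in> carrier (tensor_algebra X)" .
qed

lemma Q_ideal_subset_relation_ideal:
  "(Q_ideal n :: (nat set fword \<Rightarrow>\<^sub>0 'f::field) set) \<subseteq> relation_ideal n"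
proof -
  let ?T = "tensor_algebra (Q_basis n) :: (nat set fword \<Rightarrow>\<^sub>0 'f) ring"
  let ?J = "relation_ideal n \<inter> carrier ?T"
  interpret T: ring ?T by (rule tensor_algebra_is_ring)
  have "ideal ?J ?T"
  proof (rule idealI)
    show "subgroup ?J (add_monoid ?T)"
    proof (rule T.add.subgroupI)
      fix a assume a: "a \<in> ?J"
      then have "- a \<in> ?J"
        using relation_ideal_uminus by (auto simp: tensor_algebra_def)
      moreover from this a have "\<ominus>\<^bsub>?T\<^esub> a = - a"
        by (intro T.minus_equality) (auto simp: tensor_algebra_def)
      ultimately show "\<ominus>\<^bsub>?T\<^esub> a \<in> ?J" by simp
    next
      fix a b assume "a \<in> ?J" "b \<in> ?J"
      moreover from this have "a \<oplus>\<^bsub>?T\<^esub> b \<in> carrier ?T" by auto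
      ultimately show "a \<oplus>\<^bsub>?T\<^esub> b \<in> ?J"
        by (auto simp: tensor_algebra_def intro: relation_ideal.add)
    next
      have "0 \<in> ?J" by (simp add: relation_ideal.zero tensor_algebra_def)
      then show "?J \<noteq> {}" by blast
    qed auto
  next
    fix a x assume ax: "a \<in> ?J" "x \<in> carrier ?T"
    then have "x \<otimes>\<^bsub>?T\<^esub> a \<in> carrier ?T" "a \<otimes>\<^bsub>?T\<^esub> x \<in> carrier ?T" by auto
    then show "x \<otimes>\<^bsub>?T\<^esub> a \<in> ?J" "a \<otimes>\<^bsub>?T\<^esub> x \<in> ?J"
      using ax by (auto simp: tensor_algebra_def intro: relation_ideal_mult_left relation_ideal_mult_right)
  qed (rule T.ring_axioms)
  moreover have "Q_relations n \<subseteq> ?J"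
    using Q_relations_subset relation_ideal_relation by blast
  ultimately have "Q_ideal n \<subseteq> ?J"
    unfolding Q_ideal_def by (rule T.genideal_minimal)
  then show ?thesis by auto
qed

text \<open>Setting the letters outside \<open>Q_basis n\<close> to zero retracts \<open>relation_ideal n\<close> onto \<open>Q_ideal n\<close>.\<close>

lemma relation_ideal_Int_tensor_algebra:
  fixes p :: "nat set fword \<Rightarrow>\<^sub>0 'f::field"
  assumes "p \<in> relation_ideal n" "p \<in> carrier (tensor_algebra (Q_basis n))"
  shows "p \<in> Q_ideal n"
proof -
  let ?T = "tensor_algebra (Q_basis n) :: (nat set fword \<Rightarrow>\<^sub>0 'f) ring"
  let ?g = "\<lambda>A. if A \<in> Q_basis n then basis_vec (Word [A]) else 0 :: nat set fword \<Rightarrow>\<^sub>0 'f"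
  interpret I: ideal "Q_ideal n" ?T by (rule Q_ideal_is_ideal)
  have id: "subst ?g q = q" if "q \<in> carrier ?T" for q
    using that by (intro subst_id) (auto simp: tensor_algebra_def)
  have closed: "subst ?g q \<in> carrier ?T" for q
    by (rule subst_tensor_algebra) (auto simp: tensor_algebra_def)
  have "subst ?g q \<in> Q_ideal n" if "q \<in> relation_ideal n" for q
    using that
  proof (induct q rule: relation_ideal.induct)
    case zero
    show ?case
      using additive_subgroup.zero_closed[OF I.is_additive_subgroup] by (simp add: tensor_algebra_def)
  next
    case (relation r a b)
    then have "subst ?g r = r" using id Q_relations_subset by blast
    moreover have "r \<in> Q_ideal n"
      unfolding Q_ideal_def
      using ring.genideal_self[OF tensor_algebra_is_ring Q_relations_subset] relation by blast
    then have "subst ?g a * r * subst ?g b \<in> Q_ideal n"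
      using I.I_r_closed[OF I.I_l_closed[OF _ closed] closed, of r a b] by (simp add: tensor_algebra_def)
    ultimately show ?case by (simp add: subst_mult)
  next
    case (add p q)
    then show ?case
      using additive_subgroup.a_closed[OF I.is_additive_subgroup, of "subst ?g p" "subst ?g q"]
      by (simp add: tensor_algebra_def subst_add)
  qed
  from this[OF assms(1)] show ?thesis by (simp add: id[OF assms(2)])
qed

section \<open>Homogeneous components\<close>

definition hom_part :: "nat \<Rightarrow> ('x fword \<Rightarrow>\<^sub>0 'f::field) \<Rightarrow> 'x fword \<Rightarrow>\<^sub>0 'f" where
  "hom_part i = ext scl (\<lambda>w. if length (letters w) = i then basis_vec w else 0)"

lemma hom_part_linear: "Vector_Spaces.linear scl scl (hom_part i)"
  unfolding hom_part_def by (rule scl.ext_linear)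

lemma hom_part_tensor_power:
  assumes "p \<in> tensor_power X j"
  shows "hom_part i p = (if j = i then p else 0)"
proof -
  have "hom_part i p = ext scl (\<lambda>w. if j = i then basis_vec w else 0) p"
    unfolding hom_part_def using assms by (intro scl.ext_cong) (auto simp: tensor_power_def)
  then show ?thesis by (auto simp: ext_def[of _ "\<lambda>_. 0"])
qed

lemma v_tensor_power_UNIV: "v A \<in> tensor_power UNIV 1"
  by (auto simp: v_def tensor_power_def tensor_algebra_def)

lemma Q_relation_tensor_power:
  "(Q_relation A i j :: nat set fword \<Rightarrow>\<^sub>0 'f::field) \<in> tensor_power UNIV 2"
proof -
  have mult: "a * b \<in> tensor_power UNIV 2" if "a \<in> tensor_power UNIV 1" "b \<in> tensor_power UNIV 1"
    for a b :: "nat set fword \<Rightarrow>\<^sub>0 'f"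
    using tensor_power_mult[OF that] by (simp add: numeral_2_eq_2)
  then show ?thesis
    unfolding Q_relation_def power2_eq_square
    by (intro scl.subspace_add[OF subspace_tensor_power] scl.subspace_diff[OF subspace_tensor_power]
        mult v_tensor_power_UNIV)
qed

lemma linear_in_subspace:
  assumes "Vector_Spaces.linear scl scl g" "scl.subspace S"
    and "\<And>k. g (basis_vec k) \<in> S"
  shows "g p \<in> S"
  unfolding scl.linear_ext[OF assms(1), of p] by (intro scl.ext_in_subspace assms)

text \<open>The ideal is graded because the relations are homogeneous of degree two. The factors
  \<open>a\<close> and \<open>b\<close> are arbitrary, so linearity first reduces them to words;
  then the product is homogeneous and its component is either all of it or zero.\<close>

lemma relation_ideal_hom_part: "p \<in> relation_ideal n \<Longrightarrow> hom_part i p \<in> relation_ideal n"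
proof (induct p rule: relation_ideal.induct)
  case zero
  then show ?case by (simp add: hom_part_def relation_ideal.zero)
next
  case (add p q)
  then show ?case by (simp add: hom_part_def scl.ext_add relation_ideal.add)
next
  case (relation r a b)
  note comp = Vector_Spaces.linear_compose
  show ?case
  proof (rule linear_in_subspace[where g = "\<lambda>a. hom_part i (a * r * b)"])
    fix k :: "nat set fword"
    show "hom_part i (basis_vec k * r * b) \<in> relation_ideal n"
    proof (rule linear_in_subspace[where g = "\<lambda>b. hom_part i (basis_vec k * r * b)"])
      fix l :: "nat set fword"
      have w: "basis_vec w \<in> tensor_power UNIV (length (letters w))" for w :: "nat set fword"
        by (auto simp: tensor_power_def tensor_algebra_def)
      have "r \<in> tensor_power UNIV 2"
        using relation by (auto simp: Q_relations_def Q_relation_tensor_power)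
      from hom_part_tensor_power[OF tensor_power_mult[OF tensor_power_mult[OF w this] w]]
      show "hom_part i (basis_vec k * r * basis_vec l) \<in> relation_ideal n"
        using relation_ideal.relation[OF relation] by (auto intro: relation_ideal.zero)
    next
      show "Vector_Spaces.linear scl scl (\<lambda>b. hom_part i (basis_vec k * r * b))"
        using comp[OF mult_linear(1) hom_part_linear] by (simp add: o_def)
    qed (rule subspace_relation_ideal)
  next
    show "Vector_Spaces.linear scl scl (\<lambda>a. hom_part i (a * r * b))"
      using comp[OF comp[OF mult_linear(2) mult_linear(2)] hom_part_linear] by (simp add: o_def)
  qed (rule subspace_relation_ideal)
qed

section \<open>Coordinates with respect to the normal words\<close>

context Q_level
begin

abbreviation "coords p \<equiv> act scl (\<lambda>A. ext scl (F A)) p (basis_vec [])"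
abbreviation "realize \<equiv> ext scl (monomial n)"

lemma realize_F:
  assumes "m \<in> supported (normal_words n)" "A \<subseteq> {1..n}"
  shows "qcong n (realize (ext scl (F A) m)) (v A * realize m)"
proof (rule qcong_linear[where g = "\<lambda>m. realize (ext scl (F A) m)" and h = "\<lambda>m. v A * realize m"])
  show "Vector_Spaces.linear scl scl (\<lambda>m. realize (ext scl (F A) m))"
    using Vector_Spaces.linear_compose[OF scl.ext_linear scl.ext_linear] by (simp add: o_def)
  show "Vector_Spaces.linear scl scl (\<lambda>m. v A * realize m)"
    using Vector_Spaces.linear_compose[OF scl.ext_linear mult_linear(1)] by (simp add: o_def)
next
  fix k assume "k \<in> Poly_Mapping.keys m"
  then show "qcong n (realize (ext scl (F A) (basis_vec k))) (v A * realize (basis_vec k))"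
    using assms monomial_cong[of k A] by (auto simp: qcong_def supported_def)
qed

text \<open>The spanning half. Letting a word act on the empty normal word brings it into normal
  form one letter at a time from the right, and each step is a congruence by
  \<open>monomial_cong\<close>.\<close>

lemma realize_coords:
  assumes "p \<in> carrier (tensor_algebra (Q_basis n))"
  shows "qcong n (realize (coords p)) p"
proof (rule qcong_linear[where g = "\<lambda>p. realize (coords p)" and h = "\<lambda>p. p"])
  show "Vector_Spaces.linear scl scl (\<lambda>p. realize (coords p))"
    using Vector_Spaces.linear_compose[OF act_linear scl.ext_linear] by (simp add: o_def)
  show "Vector_Spaces.linear scl scl (\<lambda>p :: nat set fword \<Rightarrow>\<^sub>0 'f. p)"
    by (rule scl.linear_id[unfolded id_def])
next
  fix k assume "k \<in> Poly_Mapping.keys p"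
  then have k: "set (letters k) \<subseteq> Q_basis n"
    using assms by (auto simp: tensor_algebra_def)
  have "foldr (\<lambda>A. ext scl (F A)) xs (basis_vec []) \<in> supported (normal_words n) \<and>
      qcong n (realize (foldr (\<lambda>A. ext scl (F A)) xs (basis_vec []))) (basis_vec (Word xs))"
    if "set xs \<subseteq> Q_basis n" for xs
    using that
  proof (induct xs)
    case Nil
    show ?case by (simp add: qcong_refl flip: zero_fword_def)
  next
    case (Cons A xs)
    let ?m = "foldr (\<lambda>A. ext scl (F A)) xs (basis_vec [])"
    from Cons have IH: "?m \<in> supported (normal_words n)" "qcong n (realize ?m) (basis_vec (Word xs))"
      and A: "A \<subseteq> {1..n}" "A \<noteq> {}"
      by (auto simp: Q_basis_def)
    have "(basis_vec (Word (A # xs)) :: nat set fword \<Rightarrow>\<^sub>0 'f) = v A * basis_vec (Word xs)"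
      using A by (simp add: v_def mult_single plus_fword_def)
    then show ?case
      using V_closed[OF IH(1)] qcong_trans[OF realize_F[OF IH(1) A(1)] qcong_mult_left[OF IH(2)]] by simp
  qed
  from this[OF k] show "qcong n (realize (coords (basis_vec k))) (basis_vec k)"
    by (simp add: act_def)
qed

lemma coords_realize:
  assumes "y \<in> supported (normal_words n)"
  shows "coords (realize y) = y"
proof (rule scl.linear_eq_on_basis[where g = "\<lambda>y. coords (realize y)"])
  show "Vector_Spaces.linear scl scl (\<lambda>y. coords (realize y))"
    using Vector_Spaces.linear_compose[OF scl.ext_linear act_linear] by (simp add: o_def)
qed (use assms act_monomial in \<open>auto simp: supported_def scl.linear_id[unfolded id_def]\<close>)

lemma realize_tensor_power:
  assumes "y \<in> supported {u \<in> normal_words n. word_degree u = i}"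
  shows "realize y \<in> tensor_power (Q_basis n) i"
  using assms monomial_tensor_power[of _ n]
  by (intro scl.ext_in_subspace[OF subspace_tensor_power]) (auto simp: supported_def)

text \<open>The coordinates of \<open>p\<close> might a priori involve words of other degrees.
  Cutting them down to degree \<open>i\<close> keeps the congruence, because the relation ideal is
  graded and every \<open>monomial n u\<close> is homogeneous.\<close>

lemma realize_surj:
  fixes p :: "nat set fword \<Rightarrow>\<^sub>0 'f"
  assumes "p \<in> tensor_power (Q_basis n) i"
  obtains y where "y \<in> supported {u \<in> normal_words n. word_degree u = i}" "qcong n (realize y) p"
proof
  let ?f = "\<lambda>u. if word_degree u = i then basis_vec u else 0 :: block list \<Rightarrow>\<^sub>0 'f"
  let ?y = "ext scl ?f (coords p)"
  have c: "coords p \<in> supported (normal_words n)"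
    by (rule act_closed) simp
  show "?y \<in> supported {u \<in> normal_words n. word_degree u = i}"
    using c scl.subspace_0[OF subspace_supported]
    by (intro scl.ext_in_subspace[OF subspace_supported]) (auto simp: supported_def)
  have "hom_part i (realize (coords p) - p) \<in> relation_ideal n"
    using realize_coords assms tensor_power_subset
    by (intro relation_ideal_hom_part) (auto simp: qcong_def)
  moreover have "hom_part i (realize (coords p)) = realize ?y"
  proof (rule scl.linear_eq_on_basis[where g = "\<lambda>y. hom_part i (realize y)"])
    show "Vector_Spaces.linear scl scl (\<lambda>y. hom_part i (realize y))"
      using Vector_Spaces.linear_compose[OF scl.ext_linear hom_part_linear] by (simp add: o_def)
    show "Vector_Spaces.linear scl scl (\<lambda>y. realize (ext scl ?f y))"
      using Vector_Spaces.linear_compose[OF scl.ext_linear scl.ext_linear] by (simp add: o_def)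
  next
    fix u assume "u \<in> Poly_Mapping.keys (coords p)"
    then have "u \<in> normal_words n" using c by (auto simp: supported_def)
    from hom_part_tensor_power[OF monomial_tensor_power[OF this, where 'f = 'f]]
    show "hom_part i (realize (basis_vec u)) = realize (ext scl ?f (basis_vec u))"
      by auto
  qed
  ultimately show "qcong n (realize ?y) p"
    using hom_part_tensor_power[OF assms, of i]
    by (simp add: qcong_def module_hom.diff[OF Vector_Spaces.linear.axioms(3)[OF hom_part_linear]])
qed

text \<open>The independence half: \<open>coords\<close> vanishes on the ideal and is a left inverse
  of \<open>realize\<close> on normal words.\<close>

lemma Q_ideal_realize_iff:
  fixes y :: "block list \<Rightarrow>\<^sub>0 'f"
  assumes "y \<in> supported (normal_words n)"
  shows "realize y \<in> Q_ideal n \<longleftrightarrow> y = 0"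
proof
  assume "realize y \<in> Q_ideal n"
  then have "realize y \<in> relation_ideal n" using Q_ideal_subset_relation_ideal by blast
  then have "coords (realize y) = 0" by (rule act_relation_ideal) simp
  then show "y = 0" by (simp add: coords_realize[OF assms])
next
  assume "y = 0"
  then show "realize y \<in> Q_ideal n"
    using relation_ideal_Int_tensor_algebra[OF relation_ideal.zero] by (simp add: tensor_algebra_def)
qed

end

section \<open>The quotient map onto \<open>Q_algebra n\<close>\<close>

context
  fixes n :: nat
begin

interpretation I: ideal "Q_ideal n" "tensor_algebra (Q_basis n) :: (nat set fword \<Rightarrow>\<^sub>0 'f::field) ring"
  by (rule Q_ideal_is_ideal)

lemma Q_proj_mult:
  fixes p q :: "nat set fword \<Rightarrow>\<^sub>0 'f::field"
  assumes "p \<in> carrier (tensor_algebra (Q_basis n))" "q \<in> carrier (tensor_algebra (Q_basis n))"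
  shows "Q_proj n p \<otimes>\<^bsub>Q_algebra n\<^esub> Q_proj n q = Q_proj n (p * q)"
  using ring_hom_mult[OF I.rcos_ring_hom assms]
  by (simp add: Q_proj_def Q_algebra_def) (simp add: tensor_algebra_def)

lemma Q_proj_add:
  fixes p q :: "nat set fword \<Rightarrow>\<^sub>0 'f::field"
  assumes "p \<in> carrier (tensor_algebra (Q_basis n))" "q \<in> carrier (tensor_algebra (Q_basis n))"
  shows "Q_proj n p \<oplus>\<^bsub>Q_algebra n\<^esub> Q_proj n q = Q_proj n (p + q)"
  using ring_hom_add[OF I.rcos_ring_hom assms]
  by (simp add: Q_proj_def Q_algebra_def) (simp add: tensor_algebra_def)

lemma Q_proj_closed:
  fixes p :: "nat set fword \<Rightarrow>\<^sub>0 'f::field"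
  assumes "p \<in> carrier (tensor_algebra (Q_basis n))"
  shows "Q_proj n p \<in> carrier (Q_algebra n)"
  using ring_hom_closed[OF I.rcos_ring_hom assms] by (simp add: Q_proj_def Q_algebra_def)

lemma Q_proj_eq_zero_iff:
  fixes p :: "nat set fword \<Rightarrow>\<^sub>0 'f::field"
  assumes "p \<in> carrier (tensor_algebra (Q_basis n))"
  shows "Q_proj n p = \<zero>\<^bsub>Q_algebra n\<^esub> \<longleftrightarrow> p \<in> Q_ideal n"
  using I.rcos_const_imp_mem[OF assms] I.a_rcos_const[of p]
  by (auto simp: Q_proj_def Q_algebra_def FactRing_def)

lemma Q_proj_zero: "Q_proj n (0 :: nat set fword \<Rightarrow>\<^sub>0 'f::field) = \<zero>\<^bsub>Q_algebra n\<^esub>"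
proof -
  have "(0 :: nat set fword \<Rightarrow>\<^sub>0 'f) \<in> carrier (tensor_algebra (Q_basis n))"
    by (simp add: tensor_algebra_def)
  then show ?thesis
    using relation_ideal_Int_tensor_algebra[OF relation_ideal.zero] by (simp add: Q_proj_eq_zero_iff)
qed

lemma Q_proj_cong:
  fixes p q :: "nat set fword \<Rightarrow>\<^sub>0 'f::field"
  assumes "p \<in> carrier (tensor_algebra (Q_basis n))" "q \<in> carrier (tensor_algebra (Q_basis n))"
    "qcong n p q"
  shows "Q_proj n p = Q_proj n q"
proof -
  interpret Q: ring "Q_algebra n :: (nat set fword \<Rightarrow>\<^sub>0 'f) set ring" by (rule Q_algebra_is_ring)
  have d: "p - q \<in> carrier (tensor_algebra (Q_basis n))"
    by (rule tensor_algebra_minus[OF assms(1,2)])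
  have "Q_proj n (p - q) = \<zero>\<^bsub>Q_algebra n\<^esub>"
    using relation_ideal_Int_tensor_algebra[OF _ d] assms(3) Q_proj_eq_zero_iff[OF d]
    by (simp add: qcong_def)
  then have "Q_proj n (p - q + q) = Q_proj n q"
    using Q_proj_add[OF d assms(2)] Q_proj_closed[OF assms(2)] by simp
  then show ?thesis by simp
qed

end

text \<open>Parallel lists are used to mirror \<open>combine\<close> of the algebra library; as
  there, surplus entries of the longer list are dropped.\<close>

definition lin_comb :: "'f list \<Rightarrow> 'k list \<Rightarrow> 'k \<Rightarrow>\<^sub>0 'f::field" where
  "lin_comb cs us = (\<Sum>(c, u)\<leftarrow>zip cs us. scl c (basis_vec u))"

lemma lin_comb_simps [simp]:
  "lin_comb [] us = 0" "lin_comb cs [] = 0"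
  "lin_comb (c # cs) (u # us) = scl c (basis_vec u) + lin_comb cs us"
  by (simp_all add: lin_comb_def)

lemma lin_comb_supported: "lin_comb cs us \<in> supported (set us)"
proof (induct cs us rule: list_induct2')
  case (4 c cs u us)
  have "supported (set us) \<subseteq> (supported (set (u # us)) :: ('a \<Rightarrow>\<^sub>0 'b) set)" by (auto simp: supported_def)
  then show ?case
    using 4 unfolding lin_comb_simps
    by (intro scl.subspace_add[OF subspace_supported] scl.subspace_scale[OF subspace_supported]) auto
qed (simp_all add: supported_def)

lemma lookup_lin_comb_notin: "u \<notin> set us \<Longrightarrow> Poly_Mapping.lookup (lin_comb cs us) u = 0"
  using lin_comb_supported[of cs us] by (auto simp: supported_def in_keys_iff)

lemma lin_comb_eq_0:
  assumes "distinct us" "lin_comb cs us = 0"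
  shows "set (take (length us) cs) \<subseteq> {0}"
  using assms
proof (induct cs us rule: list_induct2')
  case (4 c cs u us)
  then have "Poly_Mapping.lookup (scl c (basis_vec u) + lin_comb cs us) u = 0" by simp
  then have "c = 0" using 4(2) by (simp add: lookup_add lookup_lin_comb_notin)
  then show ?case using 4 by simp
qed simp_all

lemma lin_comb_lookup:
  assumes "distinct us" "y \<in> supported (set us)"
  shows "lin_comb (map (Poly_Mapping.lookup y) us) us = y"
proof -
  have "lin_comb (map (Poly_Mapping.lookup y) us) us =
      (\<Sum>u\<in>set us. scl (Poly_Mapping.lookup y u) (basis_vec u))"
    using assms(1) by (induct us) simp_all
  also have "\<dots> = ext scl basis_vec y"
    using assms(2) by (intro scl.ext_superset[symmetric]) (auto simp: supported_def)
  finally show ?thesis by simp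
qed

text \<open>The classes of the \<open>monomial n u\<close> of degree \<open>i\<close> form a basis:
  they are independent by \<open>Q_ideal_realize_iff\<close> and they span by
  \<open>realize_surj\<close>.\<close>

lemma Q_component_dimension:
  "ring.dimension (Q_algebra n :: (nat set fword \<Rightarrow>\<^sub>0 'f::field) set ring)
    (card {u \<in> normal_words n. word_degree u = i}) (Q_scalars n) (Q_component n i)"
proof -
  let ?Q = "Q_algebra n :: (nat set fword \<Rightarrow>\<^sub>0 'f) set ring"
  let ?T = "tensor_algebra (Q_basis n) :: (nat set fword \<Rightarrow>\<^sub>0 'f) ring"
  let ?B = "{u \<in> normal_words n. word_degree u = i}"
  let ?k = "\<lambda>c. Q_proj n (Poly_Mapping.single 0 c) :: (nat set fword \<Rightarrow>\<^sub>0 'f) set"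
  let ?m = "\<lambda>u. Q_proj n (monomial n u) :: (nat set fword \<Rightarrow>\<^sub>0 'f) set"
  interpret Q: ring ?Q by (rule Q_algebra_is_ring)
  interpret L: Q_level n "left_mult n :: nat set \<Rightarrow> block list \<Rightarrow> block list \<Rightarrow>\<^sub>0 'f"
    by (rule Q_level_left_mult)
  have K: "subfield (Q_scalars n) ?Q" by (rule Q_scalars_subfield)
  have "finite ?B" using graded_finite_normal_words by (simp add: graded_finite_def)
  then obtain us where us: "set us = ?B" "distinct us" using finite_distinct_list by blast
  have carrier: "L.realize y \<in> carrier ?T" if "y \<in> supported ?B" for y
    using L.realize_tensor_power[OF that] tensor_power_subset by blast
  have mono: "monomial n u \<in> carrier ?T" if "u \<in> normal_words n" for u
    using monomial_tensor_power[OF that, where 'f = 'f] tensor_power_subset by fastforce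
  have combine: "Q.combine (map ?k cs) (map ?m vs) = Q_proj n (L.realize (lin_comb cs vs))"
    if "set vs \<subseteq> ?B" for cs vs
    using that
  proof (induct cs vs rule: list_induct2')
    case (4 c cs u us)
    then have u: "monomial n u \<in> carrier ?T"
      by (intro mono) auto
    have c: "Poly_Mapping.single 0 c \<in> carrier ?T"
      by (auto simp: tensor_algebra_def zero_fword_def split: if_splits)
    have s: "L.realize (lin_comb cs us) \<in> carrier ?T"
      using lin_comb_supported[of cs us] 4(2) by (intro carrier) (auto simp: supported_def)
    have "?k c \<otimes>\<^bsub>?Q\<^esub> ?m u = Q_proj n (scl c (monomial n u))"
      using Q_proj_mult[OF c u] by (simp add: scl_conv_mult)
    moreover have "scl c (monomial n u) \<in> carrier ?T"
      using tensor_algebra_mult[OF c u] by (simp add: scl_conv_mult)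
    ultimately show ?case
      using 4 Q_proj_add[OF _ s] by (simp add: scl.ext_add scl.ext_scl)
  qed (simp_all add: Q_proj_zero)
  have Us: "set (map ?m us) \<subseteq> carrier ?Q"
    using us(1) mono by (auto intro!: Q_proj_closed)
  have Ks: "\<exists>cs. Ks = map ?k cs" if "set Ks \<subseteq> Q_scalars n" for Ks
    using that
  proof (induct Ks)
    case (Cons K Ks)
    then obtain c cs where "K = ?k c" "Ks = map ?k cs" by (auto simp: Q_scalars_def)
    then have "K # Ks = map ?k (c # cs)" by simp
    then show ?case by (rule exI)
  qed simp
  have sub: "supported ?B \<subseteq> (supported (normal_words n) :: (block list \<Rightarrow>\<^sub>0 'f) set)"
    by (auto simp: supported_def)
  have "Q.independent (Q_scalars n) (map ?m us)"
  proof (rule Q.trivial_combine_imp_independent[OF K Us])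
    fix Ks assume "set Ks \<subseteq> Q_scalars n" and eq: "Q.combine Ks (map ?m us) = \<zero>\<^bsub>?Q\<^esub>"
    from Ks[OF this(1)] obtain cs where cs: "Ks = map ?k cs" ..
    have y: "lin_comb cs us \<in> supported ?B" using lin_comb_supported us(1) by metis
    have "lin_comb cs us = 0"
      using eq Q_proj_eq_zero_iff[OF carrier[OF y]] L.Q_ideal_realize_iff sub y us(1)
      unfolding cs combine[OF equalityD1[OF us(1)]] by blast
    then have "set (take (length us) cs) \<subseteq> {0}" by (rule lin_comb_eq_0[OF us(2)])
    moreover have "?k 0 = \<zero>\<^bsub>?Q\<^esub>"
      by (simp add: Q_proj_zero)
    ultimately show "set (take (length (map ?m us)) Ks) \<subseteq> {\<zero>\<^bsub>?Q\<^esub>}"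
      by (auto simp: cs take_map)
  qed
  moreover have "Q.Span (Q_scalars n) (map ?m us) = Q_component n i"
  proof (intro equalityI subsetI)
    fix x assume "x \<in> Q.Span (Q_scalars n) (map ?m us)"
    then obtain Ks' where Ks': "set Ks' \<subseteq> Q_scalars n" "x = Q.combine Ks' (map ?m us)"
      unfolding Q.Span_eq_combine_set[OF K Us] by blast
    from Ks[OF this(1)] obtain cs where "Ks' = map ?k cs" ..
    then have "x = Q_proj n (L.realize (lin_comb cs us))"
      using Ks'(2) combine[OF equalityD1[OF us(1)]] by simp
    moreover have "lin_comb cs us \<in> supported ?B" using lin_comb_supported us(1) by metis
    ultimately show "x \<in> Q_component n i"
      unfolding Q_component_def using L.realize_tensor_power by blast
  next
    fix x :: "(nat set fword \<Rightarrow>\<^sub>0 'f) set" assume "x \<in> Q_component n i"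
    then obtain p where p: "x = Q_proj n p" "p \<in> tensor_power (Q_basis n) i"
      by (auto simp: Q_component_def)
    obtain y where y: "y \<in> supported ?B" "qcong n (L.realize y) p"
      using L.realize_surj[OF p(2)] by blast
    have "x = Q_proj n (L.realize y)"
      unfolding p(1) using p(2) tensor_power_subset carrier[OF y(1)] y(2)
      by (intro Q_proj_cong[symmetric]) auto
    also have "y = lin_comb (map (Poly_Mapping.lookup y) us) us"
      by (rule lin_comb_lookup[symmetric]) (simp_all add: us y(1))
    finally have "x = Q.combine (map ?k (map (Poly_Mapping.lookup y) us)) (map ?m us)"
      unfolding combine[OF equalityD1[OF us(1)]] .
    moreover have "set (map ?k (map (Poly_Mapping.lookup y) us)) \<subseteq> Q_scalars n"
      by (auto simp: Q_scalars_def)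
    ultimately show "x \<in> Q.Span (Q_scalars n) (map ?m us)"
      unfolding Q.Span_eq_combine_set[OF K Us] by blast
  qed
  ultimately have "Q.dimension (length (map ?m us)) (Q_scalars n) (Q_component n i)"
    by (rule Q.dimensionI[OF K])
  then show ?thesis using distinct_card[OF us(2)] us(1) by simp
qed

theorem theorem1:
  fixes n :: nat
  shows "(\<forall>i. ring.finite_dimension (Q_algebra n :: (nat set fword \<Rightarrow>\<^sub>0 'f::field) set ring)
              (Q_scalars n) (Q_component n i)) \<and>
    hilbert_series (Q_algebra n :: (nat set fword \<Rightarrow>\<^sub>0 'f) set ring)
        (Q_scalars n) (Q_component n) =
      (1 - fps_X) / (1 - fps_X * (2 - fps_X) ^ n)"
proof
  interpret Q: ring "Q_algebra n :: (nat set fword \<Rightarrow>\<^sub>0 'f) set ring" by (rule Q_algebra_is_ring)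
  show "\<forall>i. Q.finite_dimension (Q_scalars n) (Q_component n i)"
    using Q.finite_dimensionI[OF Q_component_dimension] by blast
  let ?D = "1 - fps_X * (2 - fps_X) ^ n :: rat fps"
  have "hilbert_series (Q_algebra n :: (nat set fword \<Rightarrow>\<^sub>0 'f) set ring) (Q_scalars n) (Q_component n) =
      gen_fun (normal_words n) word_degree"
    using Q.dimI[OF Q_scalars_subfield Q_component_dimension]
    by (simp add: hilbert_series_def gen_fun_def over_def)
  \<comment> \<open>The constant coefficient of \<open>?D\<close> is 1, so \<open>?D\<close> may be
    cancelled from the product formula for the counting series.\<close>
  moreover have "?D \<noteq> 0"
  proof
    assume "?D = 0"
    then have "fps_nth ?D 0 = 0" by simp
    then show False by simp
  qed
  then have "gen_fun (normal_words n) word_degree = (1 - fps_X) / ?D"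
    unfolding gen_fun_normal_words[of n, symmetric] by simp
  ultimately show "hilbert_series (Q_algebra n :: (nat set fword \<Rightarrow>\<^sub>0 'f) set ring)
      (Q_scalars n) (Q_component n) = (1 - fps_X) / ?D"
    by simp
qed

end
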